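(* For every $n\ge 2$ let $\mathrm{conv}_n\colon\mathbb{C}^n\times\mathbb{C}^n\to\mathbb{C}^n$ be the $n$-dimensional cyclic convolution, $\mathrm{conv}_n(a,b)=(c_0,\dots,c_{n-1})$ with $c_k=\sum_{0\le i,j<n,\ i+j\equiv k \bmod n} a_ib_j$. Then the bounded coefficient complexity satisfies $$\mathcal{C}(\mathrm{conv}_n)\ \ge\ \tfrac{1}{12}\,n\log n - O(n\log\log n).$$
   Context: All logarithms are to base 2. A circuit (straight-line program over $\mathbb{C}$) with inputs $a_1,\dots,a_N$ is a sequence of instructions, each of which either forms $u\circ v$ with $\circ\in\{+,-,*\}$ from two previously computed values or inputs $u,v$, or forms $\lambda u$ for a scalar $\lambda\in\mathbb{C}$ and a previously computed value or input $u$; it computes a set of polynomials if they all occur among the computed values; its size is its number of instructions. A linear circuit uses only $+,-$ and scalar multiplications. A bilinear circuit on inputs $X_1,\dots,X_m,Y_1,\dots,Y_n$ consists of four consecutive parts: a linear circuit on the $X_i$ computing linear forms $f_1,\dots,f_k$; a linear circuit on the $Y_j$ computing linear forms $g_1,\dots,g_\ell$; a part consisting only of multiplications $f_i\cdot g_j$; and a linear circuit taking these products as inputs. A circuit is bounded coefficient (b.c.) if every scalar multiplication uses a scalar of absolute value at most $2$. For a bilinear map $\varphi$, $\mathcal{C}(\varphi)$ is the minimal size of a b.c. bilinear circuit computing $\varphi$. *)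

theory Defs
  imports
    "HOL-Analysis.Analysis"
    "HOL-Library.Landau_Symbols"
begin

text \<open>
  Operands are positions in the list of all available values: in a circuit with N inputs,
  positions below N denote the inputs and position N + t denotes the result of instruction t.
\<close>

datatype instr =
    Add nat nat
  | Sub nat nat
  | Mult nat nat
  | Scale complex nat

type_synonym circuit = "instr list"

fun operands :: "instr \<Rightarrow> nat set" where
  "operands (Add i j) = {i, j}"
| "operands (Sub i j) = {i, j}"
| "operands (Mult i j) = {i, j}"
| "operands (Scale c i) = {i}"

fun result :: "complex list \<Rightarrow> instr \<Rightarrow> complex" where
  "result vs (Add i j) = vs ! i + vs ! j"
| "result vs (Sub i j) = vs ! i - vs ! j"
| "result vs (Mult i j) = vs ! i * vs ! j"
| "result vs (Scale c i) = c * vs ! i"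

definition is_circuit :: "nat \<Rightarrow> circuit \<Rightarrow> bool" where
  "is_circuit N P \<longleftrightarrow> (\<forall>t < length P. operands (P ! t) \<subseteq> {..<N + t})"

definition run :: "nat \<Rightarrow> circuit \<Rightarrow> (nat \<Rightarrow> complex) \<Rightarrow> complex list" where
  "run N P x = foldl (\<lambda>vs c. vs @ [result vs c]) (map x [0..<N]) P"

text \<open>
  Polynomials are represented by their polynomial functions, which determine them over the
  infinite field of complex numbers. As usual, inputs count as computed at no cost.
\<close>

definition computes :: "nat \<Rightarrow> circuit \<Rightarrow> ((nat \<Rightarrow> complex) \<Rightarrow> complex) set \<Rightarrow> bool" where
  "computes N P F \<longleftrightarrow> (\<forall>f\<in>F. \<exists>i < N + length P. \<forall>x. run N P x ! i = f x)"

fun linear_instr :: "instr \<Rightarrow> bool" where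
  "linear_instr (Mult i j) = False"
| "linear_instr _ = True"

text \<open>
  A linear circuit with inputs at the positions in S, occurring as a consecutive part of a
  larger circuit, whose first result is at position s.
\<close>

definition linear_part :: "nat set \<Rightarrow> nat \<Rightarrow> circuit \<Rightarrow> bool" where
  "linear_part S s P \<longleftrightarrow>
     (\<forall>t < length P. linear_instr (P ! t) \<and> operands (P ! t) \<subseteq> S \<union> {s..<s + t})"

text \<open>
  The m inputs X are at the positions below m, the n inputs Y at the positions m, ..., m + n - 1.
\<close>

definition bilinear_circuit :: "nat \<Rightarrow> nat \<Rightarrow> circuit \<Rightarrow> bool" where
  "bilinear_circuit m n P \<longleftrightarrow>
     (\<exists>P1 P2 P3 P4. P = P1 @ P2 @ P3 @ P4 \<and>
       (let s1 = m + n; s2 = s1 + length P1; s3 = s2 + length P2; s4 = s3 + length P3 in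
          linear_part {..<m} s1 P1 \<and>
          linear_part {m..<m + n} s2 P2 \<and>
          (\<forall>c\<in>set P3. \<exists>i\<in>{..<m} \<union> {s1..<s2}. \<exists>j\<in>{m..<m + n} \<union> {s2..<s3}. c = Mult i j) \<and>
          linear_part {s3..<s4} s4 P4))"

definition bounded_coeff :: "circuit \<Rightarrow> bool" where
  "bounded_coeff P \<longleftrightarrow> (\<forall>c i. Scale c i \<in> set P \<longrightarrow> cmod c \<le> 2)"

text \<open>
  A bilinear map from pairs of an m-dimensional and an n-dimensional vector to p-dimensional
  vectors is given as a function on coordinate sequences; it is meant to depend only on the
  first m and n coordinates of its arguments, and only the first p coordinates of its value
  are relevant.
\<close>

definition bc_complexity ::
  "nat \<Rightarrow> nat \<Rightarrow> nat \<Rightarrow> ((nat \<Rightarrow> complex) \<Rightarrow> (nat \<Rightarrow> complex) \<Rightarrow> nat \<Rightarrow> complex) \<Rightarrow> nat" where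
  "bc_complexity m n p \<phi> =
     (LEAST s. \<exists>P. bilinear_circuit m n P \<and> bounded_coeff P \<and>
        computes (m + n) P ((\<lambda>k x. \<phi> x (\<lambda>j. x (m + j)) k) ` {..<p}) \<and> length P = s)"

definition conv :: "nat \<Rightarrow> (nat \<Rightarrow> complex) \<Rightarrow> (nat \<Rightarrow> complex) \<Rightarrow> nat \<Rightarrow> complex" where
  "conv n a b k = (\<Sum>(i, j)\<in>{(i, j). i < n \<and> j < n \<and> (i + j) mod n = k mod n}. a i * b j)"

lemma bilinear_circuit_is_circuit:
  assumes "bilinear_circuit m n P"
  shows "is_circuit (m + n) P"
proof -
  obtain P1 P2 P3 P4 where P: "P = P1 @ P2 @ P3 @ P4"
    and a: "linear_part {..<m} (m+n) P1" "linear_part {m..<m + n} (m+n+length P1) P2"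
    "\<forall>c\<in>set P3. \<exists>i\<in>{..<m} \<union> {m+n..<m+n+length P1}. \<exists>j\<in>{m..<m + n} \<union> {m+n+length P1..<m+n+length P1+length P2}. c = Mult i j"
    "linear_part {m+n+length P1+length P2..<m+n+length P1+length P2+length P3} (m+n+length P1+length P2+length P3) P4"
    using assms unfolding bilinear_circuit_def Let_def by blast
  show ?thesis unfolding is_circuit_def
  proof (intro allI impI)
    fix t assume t: "t < length P"
    define u where "u = t - length P1"
    define v where "v = u - length P2"
    define w where "w = v - length P3"
    consider "t < length P1" | "t = length P1 + u" "u < length P2" 
      | "t = length P1 + length P2 + v" "v < length P3"
      | "t = length P1 + length P2 + length P3 + w" "w < length P4"
      using t unfolding P u_def v_def w_def by (simp, linarith)
    then show "operands (P ! t) \<subseteq> {..<m + n + t}"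
    proof cases
      case 1
      then have "operands (P1 ! t) \<subseteq> {..<m} \<union> {m+n..<m+n+t}" using a(1) unfolding linear_part_def by blast
      then show ?thesis using 1 by (fastforce simp: P nth_append)
    next
      case 2
      then have "operands (P2 ! u) \<subseteq> {m..<m + n} \<union> {m+n+length P1..<m+n+length P1+u}" using a(2) unfolding linear_part_def by blast
      then show ?thesis using 2 by (fastforce simp: P nth_append)
    next
      case 3
      then have v: "P3 ! v \<in> set P3" by simp
      show ?thesis using 3 bspec[OF a(3) v] by (auto simp: P nth_append)
    next
      case 4
      then have "operands (P4 ! w) \<subseteq> {m+n+length P1+length P2..<m+n+length P1+length P2+length P3} \<union> {m+n+length P1+length P2+length P3..<m+n+length P1+length P2+length P3+w}" using a(4) unfolding linear_part_def by blast
      then show ?thesis using 4 by (fastforce simp: P nth_append)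
    qed
  qed
qed

end

theory Submission
  imports Defs "Jordan_Normal_Form.Determinant" "HOL-Real_Asymp.Real_Asymp"
begin

text \<open>
  Morgenstern's argument: an instruction with coefficients bounded by 2 at most doubles the largest
  determinant formed from the linear forms computed so far. It is used twice. If the first part of
  the circuit is short, all the forms it computes are, up to a few directions w, of size at most
  $D = n^{1/8}$. Projecting a random sign vector onto the complement of w gives an input a on which
  every such form is at most $D$ up to a logarithmic factor, while many Fourier coefficients
  of a stay large. With this a substituted, the rest of the circuit, divided by the bound on the
  forms, is a bounded coefficient linear circuit for the circulant matrix of a, whose determinant is
  the product of the Fourier coefficients; so this rest must be long. Balancing both parts gives
  the constant 7/64, which exceeds 1/12, so that no error term is needed for large n.
\<close>

section \<open>Determinants and the Hadamard inequality\<close>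

text \<open>The exponent 1/8 is a balance point. Write \<Lambda> for about (1/2 - 1/8) log n, the
  logarithm of a typical factor of the determinant. Discarding t directions lowers the bound for the
  rest of the circuit by \<Lambda> t / 3, which is about t (log n) / 8. Conversely, t directions
  longer than D force at least t log D = t (log n) / 8 instructions in the first part. So the first
  part pays for the loss exactly; a smaller exponent would leave a deficit, a larger one would only
  decrease \<Lambda>. The constant is then 2/3 * 3/8 * 7/16. The obstacle in choosing the input is
  that second moments fix only the total energy of the Fourier coefficients, which might sit in a
  few of them, whereas a product needs many large factors. Energy is therefore measured by z^2 -
  z^4/6: its mean is still at least half of the energy left by the projection, but it never exceeds
  3/2, so many coefficients must contribute.\<close>

definition minor :: "nat \<Rightarrow> (nat \<Rightarrow> nat \<Rightarrow> complex) \<Rightarrow> complex" where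
  "minor r X = Determinant.det (Matrix.mat r r (\<lambda>(i, j). X i j))"

lemma minor_cong:
  "(\<And>i j. i < r \<Longrightarrow> j < r \<Longrightarrow> X i j = Y i j) \<Longrightarrow> minor r X = minor r Y"
  unfolding minor_def by (rule arg_cong[where f = Determinant.det]) (auto intro!: eq_matI)

text \<open>Laplace expansion: the cofactors along row \<open>k\<close> do not see that row, so a
  single \<open>C\<close> serves all \<open>u\<close>. Linearity in the row follows at once.\<close>

lemma minor_expand_row:
  assumes "k < r"
  obtains C where "\<And>u. minor r (X(k := u)) = (\<Sum>j<r. u j * C j)"
proof -
  let ?M = "\<lambda>u. Matrix.mat r r (\<lambda>(i, j). (X(k := u)) i j)"
  have del: "mat_delete (?M u) k j = mat_delete (?M (\<lambda>_. 0)) k j" for u j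
    by (rule eq_matI) (auto simp: mat_delete_def)
  show thesis
  proof (rule that[of "\<lambda>j. cofactor (?M (\<lambda>_. 0)) k j"])
    fix u
    have "cofactor (?M u) k j = cofactor (?M (\<lambda>_. 0)) k j" for j
      unfolding cofactor_def del[of u] ..
    moreover have "minor r (X(k := u)) = (\<Sum>j<r. ?M u $$ (k, j) * cofactor (?M u) k j)"
      unfolding minor_def by (rule laplace_expansion_row) (use assms in auto)
    moreover have "?M u $$ (k, j) = u j" if "j < r" for j
      using that assms by simp
    ultimately show "minor r (X(k := u)) = (\<Sum>j<r. u j * cofactor (?M (\<lambda>_. 0)) k j)"
      by simp
  qed
qed

lemma minor_row_linear:
  assumes "k < r"
  shows "minor r (X(k := \<lambda>l. a * u l + b * v l)) = a * minor r (X(k := u)) + b * minor r (X(k := v))"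
proof -
  obtain C where C: "\<And>u. minor r (X(k := u)) = (\<Sum>j<r. u j * C j)"
    using minor_expand_row[OF assms] by blast
  show ?thesis
    unfolding C by (simp add: sum.distrib sum_distrib_left algebra_simps)
qed

lemma minor_repeated_row:
  assumes "i < r" "j < r" "i \<noteq> j" "X i = X j"
  shows "minor r X = 0"
  unfolding minor_def using assms
  by (intro Determinant.det_identical_rows[of _ r i j]) (auto intro!: eq_vecI)

lemma minor_subtract_row:
  assumes "k < r" "j < r" "k \<noteq> j"
  shows "minor r (X(k := \<lambda>l. X k l - c * X j l)) = minor r X"
proof -
  have "minor r (X(k := \<lambda>l. 1 * X k l + (- c) * X j l)) =
      1 * minor r (X(k := X k)) + (- c) * minor r (X(k := X j))"
    by (rule minor_row_linear) (fact assms)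
  moreover have "minor r (X(k := X j)) = 0"
    using assms by (intro minor_repeated_row[of k _ j]) auto
  ultimately show ?thesis by simp
qed

lemma minor_mult:
  "minor r (\<lambda>i j. \<Sum>k<r. X i k * Y k j) = minor r X * minor r Y"
proof -
  have "Matrix.mat r r (\<lambda>(i, j). \<Sum>k<r. X i k * Y k j) =
      Matrix.mat r r (\<lambda>(i, j). X i j) * Matrix.mat r r (\<lambda>(i, j). Y i j)"
    by (rule eq_matI) (auto simp: scalar_prod_def atLeast0LessThan)
  then show ?thesis
    unfolding minor_def by (metis Determinant.det_mult mat_carrier)
qed

lemma minor_transpose: "minor r (\<lambda>i j. X j i) = minor r X"
proof -
  have "Matrix.mat r r (\<lambda>(i, j). X j i) = transpose_mat (Matrix.mat r r (\<lambda>(i, j). X i j))"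
    by (rule eq_matI) auto
  then show ?thesis
    unfolding minor_def by (metis Determinant.det_transpose mat_carrier)
qed

lemma minor_triangular:
  assumes "\<And>i j. i < j \<Longrightarrow> j < r \<Longrightarrow> X i j = 0"
  shows "minor r X = (\<Prod>i<r. X i i)"
proof -
  let ?M = "Matrix.mat r r (\<lambda>(i, j). X i j)"
  have "minor r X = prod_list (diag_mat ?M)"
    unfolding minor_def by (rule det_lower_triangular[of r]) (use assms in auto)
  also have "diag_mat ?M = map (\<lambda>i. X i i) [0..<r]"
    by (auto simp: diag_mat_def)
  also have "prod_list \<dots> = (\<Prod>i<r. X i i)"
    by (simp add: prod.distinct_set_conv_list[symmetric] atLeast0LessThan)
  finally show ?thesis .
qed

lemma minor_cnj: "minor r (\<lambda>i j. cnj (X i j)) = cnj (minor r X)"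
  unfolding minor_def Determinant.det_def
  by (auto simp: sign_def intro!: sum.cong)

section \<open>Inner products and orthogonalization of rows\<close>

definition ip :: "nat \<Rightarrow> (nat \<Rightarrow> complex) \<Rightarrow> (nat \<Rightarrow> complex) \<Rightarrow> complex" where
  "ip n u v = (\<Sum>l<n. u l * cnj (v l))"

definition sqnorm :: "nat \<Rightarrow> (nat \<Rightarrow> complex) \<Rightarrow> real" where
  "sqnorm n u = (\<Sum>l<n. (cmod (u l))\<^sup>2)"

lemma sqnorm_nonneg [simp]: "0 \<le> sqnorm n u"
  by (simp add: sqnorm_def sum_nonneg)

lemma ip_self: "ip n u u = of_real (sqnorm n u)"
  by (simp add: ip_def sqnorm_def complex_norm_square[symmetric])

lemma ip_cnj: "cnj (ip n u v) = ip n v u"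
  by (simp add: ip_def mult.commute)

lemma ip_diff_left: "ip n (\<lambda>l. u l - v l) w = ip n u w - ip n v w"
  by (simp add: ip_def algebra_simps sum_subtractf)

lemma ip_scale_left: "ip n (\<lambda>l. c * u l) w = c * ip n u w"
  by (simp add: ip_def algebra_simps sum_distrib_left)

lemma ip_sum_left: "ip n (\<lambda>l. \<Sum>j\<in>A. u j l) w = (\<Sum>j\<in>A. ip n (u j) w)"
  unfolding ip_def by (simp add: sum_distrib_right sum.swap[of _ A])

lemma ip_eq_0_if_sqnorm_0:
  assumes "sqnorm n u = 0"
  shows "ip n v u = 0"
proof -
  have "\<forall>l<n. u l = 0"
    using assms by (simp add: sqnorm_def sum_nonneg_eq_0_iff)
  then show ?thesis by (simp add: ip_def)
qed

lemma sqnorm_subtract_projection: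
  fixes u w :: "nat \<Rightarrow> complex"
  assumes "sqnorm n w \<noteq> 0"
  defines "u' \<equiv> \<lambda>l. u l - ip n u w / ip n w w * w l"
  shows "ip n u' w = 0" "sqnorm n u' \<le> sqnorm n u"
proof -
  define c where "c = ip n u w / ip n w w"
  have u': "u' = (\<lambda>l. u l - c * w l)" by (simp add: u'_def c_def)
  have ww: "ip n w w \<noteq> 0" using assms by (simp add: ip_self)
  show 0: "ip n u' w = 0"
    using ww unfolding u' ip_diff_left ip_scale_left by (simp add: c_def)
  have "complex_of_real (sqnorm n u) = ip n (\<lambda>l. u' l + c * w l) (\<lambda>l. u' l + c * w l)"
    by (simp add: ip_self u')
  also have "\<dots> = ip n u' u' + cnj c * ip n u' w + c * cnj (ip n u' w) + c * cnj c * ip n w w"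
    by (simp add: ip_def sum.distrib sum_distrib_left algebra_simps)
  also have "\<dots> = of_real (sqnorm n u' + (cmod c)\<^sup>2 * sqnorm n w)"
    by (simp add: 0 ip_self complex_norm_square[symmetric])
  finally have "sqnorm n u = sqnorm n u' + (cmod c)\<^sup>2 * sqnorm n w"
    using of_real_eq_iff by blast
  then show "sqnorm n u' \<le> sqnorm n u" by simp
qed

text \<open>Induction on \<open>m\<close>: the projections onto the earlier rows are subtracted one
  at a time. Each subtraction is a row operation that preserves the determinant and does not
  increase the norm. Rows are not normalized, since that would change the determinant; a zero row is
  orthogonal to everything and is skipped.\<close>

lemma orthogonalize_row:
  assumes "k < r" and orth: "\<And>i j. i < k \<Longrightarrow> j < k \<Longrightarrow> i \<noteq> j \<Longrightarrow> ip r (Y i) (Y j) = 0" and "m \<le> k"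
  shows "\<exists>u. minor r (Y(k := u)) = minor r Y \<and> sqnorm r u \<le> sqnorm r (Y k) \<and>
           (\<forall>j<m. ip r u (Y j) = 0)"
  using \<open>m \<le> k\<close>
proof (induction m)
  case 0
  then show ?case by (intro exI[of _ "Y k"]) simp
next
  case (Suc m)
  then obtain u where u: "minor r (Y(k := u)) = minor r Y" "sqnorm r u \<le> sqnorm r (Y k)"
    "\<forall>j<m. ip r u (Y j) = 0" using Suc_leD by blast
  show ?case
  proof (cases "sqnorm r (Y m) = 0")
    case True
    then have "\<forall>j<Suc m. ip r u (Y j) = 0"
      using u(3) by (auto simp: less_Suc_eq ip_eq_0_if_sqnorm_0)
    then show ?thesis using u(1,2) by blast
  next
    case False
    define c where "c = ip r u (Y m) / ip r (Y m) (Y m)"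
    define u' where "u' = (\<lambda>l. u l - c * Y m l)"
    note p = sqnorm_subtract_projection[OF False, of u, folded c_def u'_def]
    have "minor r ((Y(k := u))(k := \<lambda>l. (Y(k := u)) k l - c * (Y(k := u)) m l)) = minor r (Y(k := u))"
      by (rule minor_subtract_row) (use \<open>k < r\<close> Suc.prems in auto)
    then have "minor r (Y(k := u')) = minor r Y"
      using u(1) Suc.prems by (simp add: u'_def)
    moreover have "ip r u' (Y j) = 0" if "j < Suc m" for j
    proof (cases "j = m")
      case False
      then have "j < m" using that by simp
      moreover from this have "ip r (Y m) (Y j) = 0" using orth Suc.prems by auto
      ultimately show ?thesis using u(3) by (simp add: u'_def ip_diff_left ip_scale_left)
    qed (use p in simp)
    ultimately show ?thesis using order_trans[OF p(2) u(2)] by blast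
  qed
qed

lemma orthogonalize_rows:
  assumes "k \<le> r"
  shows "\<exists>Y. minor r Y = minor r X \<and> (\<forall>i. sqnorm r (Y i) \<le> sqnorm r (X i)) \<and>
           (\<forall>i<k. \<forall>j<k. i \<noteq> j \<longrightarrow> ip r (Y i) (Y j) = 0)"
  using assms
proof (induction k)
  case 0
  then show ?case by auto
next
  case (Suc k)
  then obtain Y where Y: "minor r Y = minor r X" "\<And>i. sqnorm r (Y i) \<le> sqnorm r (X i)"
    "\<And>i j. i < k \<Longrightarrow> j < k \<Longrightarrow> i \<noteq> j \<Longrightarrow> ip r (Y i) (Y j) = 0" by auto
  obtain u where u: "minor r (Y(k := u)) = minor r Y" "sqnorm r u \<le> sqnorm r (Y k)"
    "\<And>j. j < k \<Longrightarrow> ip r u (Y j) = 0"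
    using orthogonalize_row[of k r Y k] Suc.prems Y(3) by auto
  have u': "ip r (Y j) u = 0" if "j < k" for j
    using u(3)[OF that] ip_cnj[of r u "Y j"] by simp
  show ?case
    using Y u u' order_trans[OF u(2) Y(2)]
    by (intro exI[of _ "Y(k := u)"]) (simp del: fun_upd_apply, auto simp: less_Suc_eq)
qed

text \<open>After orthogonalization the Gram matrix of the rows is diagonal; its determinant is both
  the squared modulus of the minor and the product of the squared row norms.\<close>

theorem hadamard_inequality:
  assumes "\<And>i. i < r \<Longrightarrow> sqnorm r (X i) \<le> 1"
  shows "cmod (minor r X) \<le> 1"
proof -
  obtain Y where Y: "minor r Y = minor r X" "\<And>i. sqnorm r (Y i) \<le> sqnorm r (X i)"
    "\<And>i j. i < r \<Longrightarrow> j < r \<Longrightarrow> i \<noteq> j \<Longrightarrow> ip r (Y i) (Y j) = 0"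
    using orthogonalize_rows[of r r X] by auto
  have "complex_of_real ((cmod (minor r Y))\<^sup>2) = minor r Y * cnj (minor r Y)"
    by (rule complex_norm_square)
  also have "cnj (minor r Y) = minor r (\<lambda>i j. cnj (Y j i))"
    unfolding minor_cnj[symmetric] by (rule minor_transpose[symmetric])
  also have "minor r Y * minor r (\<lambda>i j. cnj (Y j i)) = minor r (\<lambda>i j. \<Sum>k<r. Y i k * cnj (Y j k))"
    by (rule minor_mult[symmetric])
  also have "\<dots> = minor r (\<lambda>i j. ip r (Y i) (Y j))"
    by (simp add: ip_def)
  also have "\<dots> = (\<Prod>i<r. ip r (Y i) (Y i))"
    using Y(3) by (intro minor_triangular) auto
  also have "\<dots> = of_real (\<Prod>i<r. sqnorm r (Y i))"
    by (simp add: ip_self)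
  finally have "(cmod (minor r X))\<^sup>2 = (\<Prod>i<r. sqnorm r (Y i))"
    unfolding Y(1) of_real_eq_iff .
  also have "\<dots> \<le> 1"
    using assms order_trans[OF Y(2)] by (intro prod_le_1) auto
  finally show ?thesis
    by (simp add: power_le_one_iff abs_square_le_1)
qed

section \<open>Bounded coefficient spans\<close>

definition minors_bounded :: "nat \<Rightarrow> (nat \<Rightarrow> complex) set \<Rightarrow> real \<Rightarrow> bool" where
  "minors_bounded r V b \<longleftrightarrow> (\<forall>X. (\<forall>i<r. X i \<in> V) \<longrightarrow> cmod (minor r X) \<le> b)"

text \<open>
  Scaling by a factor of modulus at most 1 does not increase any determinant and is not counted:
  this is what makes the multiplications by the bounded forms of the first part free.
\<close>

inductive bc_span :: "(nat \<Rightarrow> complex) set \<Rightarrow> nat \<Rightarrow> (nat \<Rightarrow> complex) set \<Rightarrow> bool"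
  for V0 where
  init: "bc_span V0 0 V0"
| step: "bc_span V0 s V \<Longrightarrow> u \<in> V \<Longrightarrow> v \<in> V \<Longrightarrow> cmod a + cmod b \<le> 2 \<Longrightarrow>
    bc_span V0 (Suc s) (insert (\<lambda>l. a * u l + b * v l) V)"
| shrink: "bc_span V0 s V \<Longrightarrow> u \<in> V \<Longrightarrow> cmod a \<le> 1 \<Longrightarrow>
    bc_span V0 s (insert (\<lambda>l. a * u l) V)"

lemma bc_span_mono: "bc_span V0 s V \<Longrightarrow> V0 \<subseteq> V"
  by (induction rule: bc_span.induct) auto

text \<open>A minor containing the new row twice vanishes, one containing it once splits by
  linearity into two old minors, and one without it keeps the old bound, whence
  \<open>1 \<le> c\<close>. The case \<open>c = 2\<close> serves a counted instruction,
  \<open>c = 1\<close> a free shrinking.\<close>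

lemma minors_bounded_insert:
  assumes V: "minors_bounded r V b" and "0 \<le> b" and u: "u \<in> V" and v: "v \<in> V"
    and c: "cmod \<alpha> + cmod \<beta> \<le> c" "1 \<le> c"
  shows "minors_bounded r (insert (\<lambda>l. \<alpha> * u l + \<beta> * v l) V) (c * b)"
  unfolding minors_bounded_def
proof (intro allI impI)
  fix X assume X: "\<forall>i<r. X i \<in> insert (\<lambda>l. \<alpha> * u l + \<beta> * v l) V"
  define w where "w = (\<lambda>l. \<alpha> * u l + \<beta> * v l)"
  have nn: "0 \<le> c * b" using assms by simp
  show "cmod (minor r X) \<le> c * b"
  proof (cases "\<forall>i<r. X i \<in> V")
    case True
    then have "cmod (minor r X) \<le> 1 * b" using V by (simp add: minors_bounded_def)
    also have "\<dots> \<le> c * b" using c \<open>0 \<le> b\<close> by (intro mult_right_mono)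
    finally show ?thesis .
  next
    case False
    then obtain k where k: "k < r" "X k = w" using X by (auto simp: w_def)
    show ?thesis
    proof (cases "\<exists>j<r. j \<noteq> k \<and> X j = w")
      case True
      then have "minor r X = 0" using k minor_repeated_row[of k r _ X] by metis
      then show ?thesis using nn by simp
    next
      case False
      then have XV: "X j \<in> V" if "j < r" "j \<noteq> k" for j using X that by (auto simp: w_def)
      have "minor r X = minor r (X(k := \<lambda>l. \<alpha> * u l + \<beta> * v l))"
        by (subst fun_upd_idem) (simp_all add: k w_def)
      also have "\<dots> = \<alpha> * minor r (X(k := u)) + \<beta> * minor r (X(k := v))"
        by (rule minor_row_linear) (fact k)
      finally have "cmod (minor r X) \<le> cmod \<alpha> * cmod (minor r (X(k := u))) + cmod \<beta> * cmod (minor r (X(k := v)))"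
        by (simp only:) (rule order_trans[OF norm_triangle_ineq], simp add: norm_mult)
      also have "\<dots> \<le> cmod \<alpha> * b + cmod \<beta> * b"
        using V XV u v unfolding minors_bounded_def
        by (intro add_mono mult_left_mono) auto
      also have "\<dots> = (cmod \<alpha> + cmod \<beta>) * b" by (simp add: algebra_simps)
      also have "\<dots> \<le> c * b" using c \<open>0 \<le> b\<close> by (intro mult_right_mono)
      finally show ?thesis .
    qed
  qed
qed

lemma minors_bounded_bc_span:
  assumes "bc_span V0 s V" and "minors_bounded r V0 b" and "0 \<le> b"
  shows "minors_bounded r V (2 ^ s * b)"
  using assms
proof (induction rule: bc_span.induct)
  case (step s V u v a b')
  then have "minors_bounded r V (2 ^ s * b)" "0 \<le> 2 ^ s * b" by auto
  from minors_bounded_insert[OF this step.hyps(2,3,4)] show ?case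
    by (simp add: mult.assoc)
next
  case (shrink s V u a)
  then have "minors_bounded r V (2 ^ s * b)" "0 \<le> 2 ^ s * b" by auto
  from minors_bounded_insert[OF this shrink.hyps(2) shrink.hyps(2), of a 0 1] shrink.hyps(3)
  show ?case by simp
qed simp

text \<open>Linear changes of coordinates preserve instruction counts. This allows determinants to
  be taken in the coordinates with respect to an orthonormal system instead of the standard
  ones.\<close>

lemma bc_span_image:
  assumes "bc_span V0 s V"
    and T: "\<And>a b u v. T (\<lambda>l. a * u l + b * v l) = (\<lambda>l. a * T u l + b * T v l)"
  shows "bc_span (T ` V0) s (T ` V)"
  using assms(1)
proof (induction rule: bc_span.induct)
  case init
  show ?case by (rule bc_span.init)
next
  case (step s V u v a b)
  then show ?case by (auto simp: T intro: bc_span.step)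
next
  case (shrink s V u a)
  have "T (\<lambda>l. a * u l) = (\<lambda>l. a * T u l)"
    using T[of a u 0 u] by simp
  then show ?case using shrink by (auto intro: bc_span.shrink)
qed

section \<open>Orthonormal systems capturing the long forms of a span\<close>

definition orthonormal :: "nat \<Rightarrow> nat \<Rightarrow> (nat \<Rightarrow> nat \<Rightarrow> complex) \<Rightarrow> bool" where
  "orthonormal n t w \<longleftrightarrow> (\<forall>i<t. \<forall>j<t. ip n (w i) (w j) = (if i = j then 1 else 0))"

definition residual :: "nat \<Rightarrow> nat \<Rightarrow> (nat \<Rightarrow> nat \<Rightarrow> complex) \<Rightarrow> (nat \<Rightarrow> complex) \<Rightarrow> nat \<Rightarrow> complex" where
  "residual n t w f = (\<lambda>l. f l - (\<Sum>j<t. ip n f (w j) * w j l))"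

lemma ip_residual:
  assumes "orthonormal n t w" "i < t"
  shows "ip n (residual n t w f) (w i) = 0"
proof -
  have "ip n (residual n t w f) (w i) = ip n f (w i) - (\<Sum>j<t. ip n f (w j) * ip n (w j) (w i))"
    by (simp add: residual_def ip_diff_left ip_sum_left ip_scale_left)
  also have "(\<Sum>j<t. ip n f (w j) * ip n (w j) (w i)) = (\<Sum>j<t. if j = i then ip n f (w j) else 0)"
    using assms by (intro sum.cong) (auto simp: orthonormal_def)
  finally show ?thesis using assms by simp
qed

lemma sqnorm_residual:
  assumes "orthonormal n t w"
  shows "sqnorm n (residual n t w f) = sqnorm n f - (\<Sum>j<t. (cmod (ip n f (w j)))\<^sup>2)"
proof -
  let ?r = "residual n t w f"
  have *: "ip n (\<lambda>l. \<Sum>j<t. ip n f (w j) * w j l) g = (\<Sum>j<t. ip n f (w j) * ip n (w j) g)" for g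
    by (simp add: ip_sum_left ip_scale_left)
  have "ip n (w i) ?r = 0" if "i < t" for i
    using ip_residual[OF assms that] ip_cnj[of n ?r "w i"] by simp
  then have "ip n ?r ?r = ip n f ?r"
    unfolding residual_def[of n t w f] by (simp add: ip_diff_left *)
  also have "\<dots> = cnj (ip n ?r f)" by (simp add: ip_cnj)
  also have "\<dots> = cnj (ip n f f - (\<Sum>j<t. ip n f (w j) * ip n (w j) f))"
    unfolding residual_def ip_diff_left * ..
  also have "(\<Sum>j<t. ip n f (w j) * ip n (w j) f) = (\<Sum>j<t. of_real ((cmod (ip n f (w j)))\<^sup>2))"
    by (intro sum.cong refl) (metis complex_norm_square ip_cnj)
  finally have "complex_of_real (sqnorm n ?r) = of_real (sqnorm n f - (\<Sum>j<t. (cmod (ip n f (w j)))\<^sup>2))"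
    by (simp add: ip_self)
  then show ?thesis using of_real_eq_iff by blast
qed

lemma bessel_inequality:
  assumes "orthonormal n t w"
  shows "(\<Sum>j<t. (cmod (ip n f (w j)))\<^sup>2) \<le> sqnorm n f"
  using sqnorm_residual[OF assms, of f] sqnorm_nonneg[of n "residual n t w f"] by linarith

definition unit_vector :: "nat \<Rightarrow> nat \<Rightarrow> complex" where
  "unit_vector i = (\<lambda>l. if l = i then 1 else 0)"

lemma sqnorm_unit_vector: "i < n \<Longrightarrow> sqnorm n (unit_vector i) = 1"
proof -
  assume "i < n"
  have "sqnorm n (unit_vector i) = (\<Sum>l<n. if l = i then 1 else 0)"
    unfolding sqnorm_def unit_vector_def by (intro sum.cong) auto
  then show ?thesis using \<open>i < n\<close> by simp
qed

text \<open>
  Gram-Schmidt vectors w of large vectors f of V: the condition on f states that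
  f i lies in the span of w 0, ..., w i, so the matrix of inner products is triangular.
\<close>

definition greedy :: "nat \<Rightarrow> (nat \<Rightarrow> complex) set \<Rightarrow> real \<Rightarrow> nat \<Rightarrow> (nat \<Rightarrow> nat \<Rightarrow> complex) \<Rightarrow>
    (nat \<Rightarrow> nat \<Rightarrow> complex) \<Rightarrow> bool" where
  "greedy n V D t w f \<longleftrightarrow> orthonormal n t w \<and>
     (\<forall>i<t. f i \<in> V \<and> D \<le> cmod (ip n (f i) (w i)) \<and>
       (\<forall>u. (\<forall>j\<le>i. ip n (w j) u = 0) \<longrightarrow> ip n (f i) u = 0))"

text \<open>The new vector \<open>x\<close> is the normalized residual of \<open>h\<close>; the
  inner product of \<open>h\<close> with \<open>x\<close> is the residual norm \<open>s\<close>,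
  which exceeds \<open>D\<close>.\<close>

lemma greedy_extend:
  assumes g: "greedy n V D t w f" and h: "h \<in> V" and D: "0 < D"
    and big: "D\<^sup>2 < sqnorm n (residual n t w h)"
  shows "\<exists>w' f'. greedy n V D (Suc t) w' f'"
proof -
  define s where "s = sqrt (sqnorm n (residual n t w h))"
  have s2: "s\<^sup>2 = sqnorm n (residual n t w h)" by (simp add: s_def)
  have s: "D < s" using big D by (simp add: s_def real_less_rsqrt)
  have s0: "s \<noteq> 0" using s D by simp
  define x where "x = (\<lambda>l. of_real (1 / s) * residual n t w h l)"
  have on: "orthonormal n t w" using g by (simp add: greedy_def)
  have xw: "ip n x (w i) = 0" if "i < t" for i
    using ip_residual[OF on that] unfolding x_def ip_scale_left by simp
  then have wx: "ip n (w i) x = 0" if "i < t" for i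
    using that ip_cnj[of n x "w i"] by simp
  have rx: "residual n t w h = (\<lambda>l. of_real s * x l)"
    using s0 by (simp add: x_def)
  have "of_real (s\<^sup>2) = ip n (\<lambda>l. of_real s * x l) (\<lambda>l. of_real s * x l)"
    unfolding rx[symmetric] ip_self s2 ..
  also have "\<dots> = of_real (s\<^sup>2) * ip n x x"
    by (simp add: ip_def sum_distrib_left power2_eq_square algebra_simps)
  finally have xx: "ip n x x = 1" using s0 by simp
  \<comment> \<open>This expands \<open>h\<close> in the system enlarged by \<open>x\<close>. It
    yields both the diagonal entry (for \<open>u = x\<close>) and the span condition.\<close>
  have hdec: "ip n h u = of_real s * ip n x u + (\<Sum>j<t. ip n h (w j) * ip n (w j) u)" for u
  proof -
    have "ip n (residual n t w h) u = ip n h u - (\<Sum>j<t. ip n h (w j) * ip n (w j) u)"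
      by (simp add: residual_def ip_diff_left ip_sum_left ip_scale_left)
    then show ?thesis unfolding rx ip_scale_left by simp
  qed
  have "greedy n V D (Suc t) (w(t := x)) (f(t := h))"
    unfolding greedy_def
  proof (intro conjI allI impI)
    show "orthonormal n (Suc t) (w(t := x))"
      using on wx xw xx by (auto simp: orthonormal_def less_Suc_eq)
  next
    fix i assume i: "i < Suc t"
    show "(f(t := h)) i \<in> V" using g h i by (auto simp: greedy_def less_Suc_eq)
    show "D \<le> cmod (ip n ((f(t := h)) i) ((w(t := x)) i))"
    proof (cases "i = t")
      case True
      then show ?thesis using s D hdec[of x] by (simp add: xx wx)
    next
      case False
      then show ?thesis using g i by (auto simp: greedy_def)
    qed
    fix u assume u: "\<forall>j\<le>i. ip n ((w(t := x)) j) u = 0"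
    show "ip n ((f(t := h)) i) u = 0"
    proof (cases "i = t")
      case True
      have "ip n (w j) u = 0" if "j < t" for j
        using u[rule_format, of j] that True by simp
      moreover have "ip n x u = 0" using u True by auto
      ultimately show ?thesis using True hdec[of u] by simp
    next
      case False
      then have "i < t" using i by simp
      moreover have "\<forall>j\<le>i. ip n (w j) u = 0"
        using u \<open>i < t\<close> by simp
      ultimately show ?thesis using g False by (simp add: greedy_def)
    qed
  qed
  then show ?thesis by blast
qed

text \<open>In the coordinates with respect to \<open>w\<close>, the unit vectors have norm at most
  1 by Bessel, so their minors are at most 1 by Hadamard and those of \<open>V\<close> at most
  \<open>2 ^ s\<close>. The minor formed by the \<open>f i\<close> is triangular with diagonal
  entries of modulus at least \<open>D\<close>.\<close>

lemma greedy_bound: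
  assumes V: "bc_span (unit_vector ` {..<n}) s V" and g: "greedy n V D t w f" and D: "0 < D"
  shows "D ^ t \<le> 2 ^ s"
proof -
  have on: "orthonormal n t w" using g by (simp add: greedy_def)
  define T where "T f = (\<lambda>j. ip n f (w j))" for f
  have T: "T (\<lambda>l. a * u l + b * v l) = (\<lambda>l. a * T u l + b * T v l)" for a b u v
    by (simp add: T_def ip_def sum.distrib sum_distrib_left algebra_simps)
  have "minors_bounded t (T ` unit_vector ` {..<n}) 1"
    unfolding minors_bounded_def
  proof (intro allI impI hadamard_inequality)
    fix X i assume "\<forall>i<t. X i \<in> T ` unit_vector ` {..<n}" "i < t"
    then obtain k where k: "k < n" "X i = T (unit_vector k)" by blast
    have "sqnorm t (X i) = (\<Sum>j<t. (cmod (ip n (unit_vector k) (w j)))\<^sup>2)"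
      by (simp add: k sqnorm_def T_def)
    also have "\<dots> \<le> 1"
      using bessel_inequality[OF on, of "unit_vector k"] sqnorm_unit_vector[OF k(1)] by simp
    finally show "sqnorm t (X i) \<le> 1" .
  qed
  then have bd: "minors_bounded t (T ` V) (2 ^ s * 1)"
    by (intro minors_bounded_bc_span[OF bc_span_image[OF V T]]) auto
  have "D ^ t = (\<Prod>i<t. D)" by simp
  also have "\<dots> \<le> (\<Prod>i<t. cmod (ip n (f i) (w i)))"
    using g D by (intro prod_mono) (auto simp: greedy_def)
  also have "\<dots> = cmod (\<Prod>i<t. T (f i) i)" by (simp add: T_def prod_norm)
  also have "(\<Prod>i<t. T (f i) i) = minor t (\<lambda>i. T (f i))"
  proof (rule minor_triangular[symmetric])
    fix i j :: nat assume "i < j" "j < t"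
    moreover from this have "\<forall>k\<le>i. ip n (w k) (w j) = 0"
      using on by (auto simp: orthonormal_def)
    ultimately show "T (f i) j = 0" using g by (simp add: T_def greedy_def)
  qed
  also have "cmod \<dots> \<le> 2 ^ s * 1"
    using bd g by (auto simp: minors_bounded_def greedy_def)
  finally show ?thesis by simp
qed

text \<open>As \<open>D > 1\<close>, \<open>greedy_bound\<close> excludes arbitrarily long greedy
  systems. A system that cannot be extended leaves only short residuals.\<close>

lemma small_residuals:
  assumes V: "bc_span (unit_vector ` {..<n}) s V" and D: "1 < D"
  obtains t w where "orthonormal n t w" "D ^ t \<le> 2 ^ s"
    "\<And>f. f \<in> V \<Longrightarrow> sqnorm n (residual n t w f) \<le> D\<^sup>2"
proof -
  have D0: "0 < D" using D by simp
  have "\<exists>t w f. greedy n V D t w f \<and> (\<forall>h\<in>V. sqnorm n (residual n t w h) \<le> D\<^sup>2)"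
  proof (rule ccontr)
    assume no: "\<not> ?thesis"
    have "\<exists>w f. greedy n V D t w f" for t
    proof (induction t)
      case 0
      show ?case by (simp add: greedy_def orthonormal_def)
    next
      case (Suc t)
      then obtain w f where g: "greedy n V D t w f" by blast
      then have "\<not> (\<forall>h\<in>V. sqnorm n (residual n t w h) \<le> D\<^sup>2)" using no by blast
      then obtain h where "h \<in> V" "D\<^sup>2 < sqnorm n (residual n t w h)"
        unfolding not_le[symmetric] by blast
      then show ?case using greedy_extend[OF g _ D0] by blast
    qed
    then have "D ^ t \<le> 2 ^ s" for t using greedy_bound[OF V _ D0] by blast
    moreover obtain t where "2 ^ s < D ^ t" using real_arch_pow[OF D] by blast
    ultimately show False by (meson not_le)
  qed
  then obtain t w f where g: "greedy n V D t w f"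
    and h: "\<And>h. h \<in> V \<Longrightarrow> sqnorm n (residual n t w h) \<le> D\<^sup>2" by blast
  show thesis
    by (rule that[OF _ greedy_bound[OF V g D0] h]) (use g in \<open>simp_all add: greedy_def\<close>)
qed

section \<open>Averages over signs\<close>

text \<open>The mean over all sign vectors of length \<open>n\<close>, continued by 0. The recursion
  over coordinates replaces a probability space and turns moment estimates into inductions in which
  the last sign is averaged first.\<close>

primrec avg :: "nat \<Rightarrow> ((nat \<Rightarrow> real) \<Rightarrow> real) \<Rightarrow> real" where
  "avg 0 F = F (\<lambda>_. 0)"
| "avg (Suc n) F = (avg n (\<lambda>e. F (e(n := 1))) + avg n (\<lambda>e. F (e(n := -1)))) / 2"

lemma avg_add: "avg n (\<lambda>e. F e + G e) = avg n F + avg n G"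
  by (induction n arbitrary: F G) (auto simp: field_simps)

lemma avg_cmult: "avg n (\<lambda>e. c * F e) = c * avg n F"
  by (induction n arbitrary: F) (auto simp: field_simps)

lemma avg_const [simp]: "avg n (\<lambda>_. c) = c"
  by (induction n) auto

lemma avg_diff: "avg n (\<lambda>e. F e - G e) = avg n F - avg n G"
  using avg_add[of n F "\<lambda>e. -1 * G e"] unfolding avg_cmult by simp

lemma avg_sum: "finite A \<Longrightarrow> avg n (\<lambda>e. \<Sum>i\<in>A. F i e) = (\<Sum>i\<in>A. avg n (F i))"
  by (induction A rule: finite_induct) (auto simp: avg_add)

lemma avg_mono: "(\<And>e. F e \<le> G e) \<Longrightarrow> avg n F \<le> avg n G"
proof (induction n arbitrary: F G)
  case (Suc n)
  have "avg n (\<lambda>e. F (e(n := c))) \<le> avg n (\<lambda>e. G (e(n := c)))" for c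
    by (rule Suc.IH) (rule Suc.prems)
  from this[of 1] this[of "-1"] show ?case by simp
qed simp

text \<open>The existence step of the probabilistic method.\<close>

lemma avg_le_value: "\<exists>e. avg n F \<le> F e"
proof (induction n arbitrary: F)
  case (Suc n)
  obtain e1 e2 where e: "avg n (\<lambda>e. F (e(n := 1))) \<le> F (e1(n := 1))"
    "avg n (\<lambda>e. F (e(n := -1))) \<le> F (e2(n := -1))"
    using Suc.IH[of "\<lambda>e. F (e(n := 1))"] Suc.IH[of "\<lambda>e. F (e(n := -1))"] by auto
  show ?case
  proof (cases "F (e1(n := 1)) \<le> F (e2(n := -1))")
    case True
    then have "avg (Suc n) F \<le> F (e2(n := -1))" using e by simp
    then show ?thesis by blast
  next
    case False
    then have "avg (Suc n) F \<le> F (e1(n := 1))" using e by simp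
    then show ?thesis by blast
  qed
qed auto

section \<open>Moments of random sign sums\<close>

definition sgnsum :: "nat \<Rightarrow> (nat \<Rightarrow> complex) \<Rightarrow> (nat \<Rightarrow> real) \<Rightarrow> complex" where
  "sgnsum n c e = (\<Sum>j<n. c j * of_real (e j))"

lemma sgnsum_Suc: "sgnsum (Suc n) c (e(n := s)) = sgnsum n c e + c n * of_real s"
proof -
  have "sgnsum n c (e(n := s)) = sgnsum n c e"
    unfolding sgnsum_def by (rule sum.cong) auto
  then show ?thesis by (simp add: sgnsum_def)
qed

lemma cmod_add_sub_squares: "(cmod (x + y))\<^sup>2 + (cmod (x - y))\<^sup>2 = 2 * (cmod x)\<^sup>2 + 2 * (cmod y)\<^sup>2"
  unfolding cmod_power2 by (simp add: power2_eq_square algebra_simps)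

text \<open>With \<open>q\<close> the real part of \<open>x * cnj y\<close>, the odd terms in
  \<open>q\<close> cancel and Cauchy-Schwarz bounds \<open>q\<^sup>2\<close>. It contributes 4 to
  the coefficient 6, the square of the sum of squares the other 2.\<close>

lemma cmod_add_sub_fourth_powers:
  "(cmod (x + y)) ^ 4 + (cmod (x - y)) ^ 4 \<le> 2 * (cmod x ^ 4 + 6 * (cmod x)\<^sup>2 * (cmod y)\<^sup>2 + cmod y ^ 4)"
proof -
  define q where "q = Re x * Re y + Im x * Im y"
  have 4: "r ^ 4 = (r\<^sup>2)\<^sup>2" for r :: real by simp
  have p: "(cmod (x + y))\<^sup>2 = (cmod x)\<^sup>2 + (cmod y)\<^sup>2 + 2 * q"
    and m: "(cmod (x - y))\<^sup>2 = (cmod x)\<^sup>2 + (cmod y)\<^sup>2 - 2 * q"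
    unfolding cmod_power2 q_def by (simp_all add: power2_eq_square algebra_simps)
  have "(cmod x)\<^sup>2 * (cmod y)\<^sup>2 = q\<^sup>2 + (Re x * Im y - Im x * Re y)\<^sup>2"
    unfolding cmod_power2 q_def by (simp add: power2_eq_square algebra_simps)
  then have q: "q\<^sup>2 \<le> (cmod x)\<^sup>2 * (cmod y)\<^sup>2" by simp
  show ?thesis
    unfolding 4 p m using q by (simp add: power2_eq_square algebra_simps)
qed

lemma avg_sgnsum_square: "avg n (\<lambda>e. (cmod (sgnsum n c e))\<^sup>2) = sqnorm n c"
proof (induction n)
  case (Suc n)
  have "avg (Suc n) (\<lambda>e. (cmod (sgnsum (Suc n) c e))\<^sup>2) =
      avg n (\<lambda>e. (cmod (sgnsum n c e + c n))\<^sup>2 + (cmod (sgnsum n c e - c n))\<^sup>2) / 2"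
    by (simp add: sgnsum_Suc avg_add)
  also have "\<dots> = sqnorm n c + (cmod (c n))\<^sup>2"
    unfolding cmod_add_sub_squares by (simp add: avg_add avg_cmult Suc.IH)
  finally show ?case by (simp add: sqnorm_def)
qed (simp add: sgnsum_def sqnorm_def)

text \<open>Khintchine's inequality for the fourth moment. In the induction step the last term is
  enlarged by the factor 3 to complete the square.\<close>

lemma avg_sgnsum_fourth_power: "avg n (\<lambda>e. cmod (sgnsum n c e) ^ 4) \<le> 3 * (sqnorm n c)\<^sup>2"
proof (induction n)
  case (Suc n)
  have "avg (Suc n) (\<lambda>e. cmod (sgnsum (Suc n) c e) ^ 4) =
      avg n (\<lambda>e. cmod (sgnsum n c e + c n) ^ 4 + cmod (sgnsum n c e - c n) ^ 4) / 2"
    by (simp add: sgnsum_Suc avg_add)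
  also have "\<dots> \<le> avg n (\<lambda>e. 2 * (cmod (sgnsum n c e) ^ 4 +
      6 * (cmod (sgnsum n c e))\<^sup>2 * (cmod (c n))\<^sup>2 + cmod (c n) ^ 4)) / 2"
    by (intro divide_right_mono avg_mono cmod_add_sub_fourth_powers) simp
  also have "\<dots> = avg n (\<lambda>e. cmod (sgnsum n c e) ^ 4 +
      (6 * (cmod (c n))\<^sup>2) * (cmod (sgnsum n c e))\<^sup>2 + cmod (c n) ^ 4)"
    unfolding avg_cmult by (simp add: algebra_simps)
  also have "\<dots> = avg n (\<lambda>e. cmod (sgnsum n c e) ^ 4) +
      6 * (cmod (c n))\<^sup>2 * sqnorm n c + cmod (c n) ^ 4"
    unfolding avg_add avg_cmult avg_sgnsum_square by simp
  also have "\<dots> \<le> 3 * (sqnorm n c)\<^sup>2 + 6 * (cmod (c n))\<^sup>2 * sqnorm n c + 3 * cmod (c n) ^ 4"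
    using Suc.IH by (intro add_mono) auto
  also have "\<dots> = 3 * (sqnorm (Suc n) c)\<^sup>2"
    by (simp add: sqnorm_def power2_eq_square power4_eq_xxxx algebra_simps)
  finally show ?case .
qed (simp add: sgnsum_def sqnorm_def)

text \<open>On [0, 1] the two exponentials are bounded by 1 + x + x^2 and 1 - x + x^2; beyond 1
  already x \<le> x^2 suffices. Evenness covers negative x.\<close>

lemma cosh_le_exp_square: "cosh x \<le> exp (x\<^sup>2)" for x :: real
proof -
  have "cosh x \<le> exp (x\<^sup>2)" if "0 \<le> x" for x :: real
  proof (cases "x \<le> 1")
    case True
    have "1 + x ^ 3 = (1 - x + x\<^sup>2) * (1 + x)"
      by (simp add: power2_eq_square power3_eq_cube algebra_simps)
    then have "1 \<le> (1 - x + x\<^sup>2) * (1 + x)" using that by (metis le_add_same_cancel1 zero_le_power)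
    then have "1 / (1 + x) \<le> 1 - x + x\<^sup>2"
      using that by (simp add: divide_le_eq)
    moreover have "exp (- x) \<le> 1 / (1 + x)"
      using that exp_ge_add_one_self[of x] unfolding exp_minus inverse_eq_divide
      by (intro divide_left_mono) auto
    moreover have "exp x \<le> 1 + x + x\<^sup>2" using exp_bound that True by simp
    ultimately have "cosh x \<le> 1 + x\<^sup>2" by (simp add: cosh_def)
    also have "\<dots> \<le> exp (x\<^sup>2)" by (rule exp_ge_add_one_self)
    finally show ?thesis .
  next
    case False
    have "cosh x \<le> exp x" using that by (simp add: cosh_def)
    also have "\<dots> \<le> exp (x\<^sup>2)" using False by (simp add: power2_eq_square)
    finally show ?thesis .
  qed
  from this[of "\<bar>x\<bar>"] show ?thesis by (cases "0 \<le> x") (auto simp: cosh_minus)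
qed

text \<open>Independence of the signs: the mean factors into the values \<open>cosh (c j)\<close>.
  This is the sub-Gaussian bound behind the control of all forms at once.\<close>

lemma avg_exp_le: "avg n (\<lambda>e. exp (\<Sum>j<n. c j * e j)) \<le> exp (\<Sum>j<n. (c j)\<^sup>2)"
proof (induction n)
  case (Suc n)
  have upd: "(\<Sum>j<n. c j * (e(n := s)) j) = (\<Sum>j<n. c j * e j)" for e and s :: real
    by (rule sum.cong) auto
  have eq: "avg n (\<lambda>e. exp (\<Sum>j<Suc n. c j * (e(n := s)) j)) =
      exp (c n * s) * avg n (\<lambda>e. exp (\<Sum>j<n. c j * e j))" for s :: real
    unfolding avg_cmult[symmetric] sum.lessThan_Suc upd by (simp add: exp_add mult.commute)
  have "avg (Suc n) (\<lambda>e. exp (\<Sum>j<Suc n. c j * e j)) =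
      cosh (c n) * avg n (\<lambda>e. exp (\<Sum>j<n. c j * e j))"
    unfolding avg.simps eq by (simp add: cosh_def algebra_simps)
  also have "\<dots> \<le> exp ((c n)\<^sup>2) * exp (\<Sum>j<n. (c j)\<^sup>2)"
    by (intro mult_mono cosh_le_exp_square Suc.IH) (use cosh_real_nonneg avg_mono[of "\<lambda>_. 0"] in auto)
  finally show ?case by (simp add: exp_add mult.commute)
qed simp

section \<open>Choosing the input by the probabilistic method\<close>

lemma parseval:
  assumes "\<And>k l. k < n \<Longrightarrow> l < n \<Longrightarrow> (\<Sum>\<nu><n. G \<nu> k * cnj (G \<nu> l)) = (if k = l then 1 else 0)"
  shows "(\<Sum>\<nu><n. (cmod (ip n (G \<nu>) u))\<^sup>2) = sqnorm n u"
proof -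
  have "complex_of_real (\<Sum>\<nu><n. (cmod (ip n (G \<nu>) u))\<^sup>2) =
      (\<Sum>\<nu><n. ip n (G \<nu>) u * cnj (ip n (G \<nu>) u))"
    by (simp only: of_real_sum complex_norm_square)
  also have "\<dots> = (\<Sum>\<nu><n. \<Sum>k<n. \<Sum>l<n. cnj (u k) * u l * (G \<nu> k * cnj (G \<nu> l)))"
    unfolding ip_def cnj_sum sum_product by (intro sum.cong refl) simp
  also have "\<dots> = (\<Sum>k<n. \<Sum>l<n. \<Sum>\<nu><n. cnj (u k) * u l * (G \<nu> k * cnj (G \<nu> l)))"
    by (subst sum.swap) (intro sum.cong refl sum.swap)
  also have "\<dots> = (\<Sum>k<n. \<Sum>l<n. if k = l then cnj (u k) * u l else 0)"
    using assms by (intro sum.cong refl) (simp add: sum_distrib_left[symmetric])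
  also have "\<dots> = ip n u u" by (simp add: ip_def mult.commute)
  finally show ?thesis unfolding ip_self of_real_eq_iff .
qed

text \<open>The orthogonal projection of \<open>e\<close> off the conjugates of the
  \<open>w j\<close>. Conjugates occur because forms are applied to inputs without conjugation,
  while \<open>ip\<close> conjugates.\<close>

definition project :: "nat \<Rightarrow> nat \<Rightarrow> (nat \<Rightarrow> nat \<Rightarrow> complex) \<Rightarrow> (nat \<Rightarrow> real) \<Rightarrow> nat \<Rightarrow> complex" where
  "project n t w e = (\<lambda>l. of_real (e l) - (\<Sum>j<t. sgnsum n (w j) e * cnj (w j l)))"

text \<open>The projection can be moved from the input to the form: a form at the projected input is
  a plain sign sum whose coefficients are the residual of the form.\<close>

lemma sum_project: "(\<Sum>l<n. f l * project n t w e l) = sgnsum n (residual n t w f) e"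
proof -
  have "(\<Sum>l<n. f l * project n t w e l) =
      (\<Sum>l<n. f l * of_real (e l)) - (\<Sum>l<n. \<Sum>j<t. sgnsum n (w j) e * (f l * cnj (w j l)))"
    by (simp add: project_def algebra_simps sum_subtractf sum_distrib_left)
  also have "(\<Sum>l<n. \<Sum>j<t. sgnsum n (w j) e * (f l * cnj (w j l))) =
      (\<Sum>j<t. ip n f (w j) * sgnsum n (w j) e)"
    by (subst sum.swap) (simp add: ip_def sum_distrib_left[symmetric] mult.commute)
  also have "\<dots> = (\<Sum>k<n. (\<Sum>j<t. ip n f (w j) * w j k) * of_real (e k))"
    by (simp add: sgnsum_def sum_distrib_left sum_distrib_right sum.swap[of _ "{..<t}"] mult_ac)
  finally show ?thesis
    by (simp add: sgnsum_def residual_def algebra_simps sum_subtractf)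
qed

text \<open>The maximum is attained at x^2 = 3. Its value 3/2 is the origin of the factor 2/3 in the
  final estimate.\<close>

lemma square_sub_fourth_power_le: "x\<^sup>2 - x ^ 4 / 6 \<le> 3 / 2" for x :: real
proof -
  have "3 / 2 - (x\<^sup>2 - x ^ 4 / 6) = (x\<^sup>2 - 3)\<^sup>2 / 6"
    by (simp add: power2_eq_square power4_eq_xxxx field_simps)
  then show ?thesis by (smt (verit) divide_nonneg_pos zero_le_power2)
qed

lemma abs_le_ln_if_exp_le:
  fixes x y :: real
  assumes "exp x \<le> M" "exp (- x) \<le> M"
  shows "\<bar>x\<bar> \<le> ln M"
proof -
  have "0 < M" using assms(1) exp_gt_zero[of x] by linarith
  then have "x \<le> ln M" "- x \<le> ln M" using assms ln_ge_iff by blast+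
  then show ?thesis by simp
qed

text \<open>
  A random sign vector is projected onto the complement of w. The fourth moment keeps many of
  the coordinates with respect to G large, while the exponential penalty keeps all forms in F small.
\<close>

lemma exists_good_input:
  fixes F :: "nat \<Rightarrow> nat \<Rightarrow> complex"
  assumes on: "orthonormal n t w" and I: "finite I" "card I \<le> K" "0 < K"
    and F: "\<And>p. p \<in> I \<Longrightarrow> sqnorm n (residual n t w (F p)) \<le> D\<^sup>2" and D: "0 < D"
    and G1: "\<And>\<nu>. \<nu> < n \<Longrightarrow> sqnorm n (G \<nu>) = 1"
    and G2: "\<And>k l. k < n \<Longrightarrow> l < n \<Longrightarrow> (\<Sum>\<nu><n. G \<nu> k * cnj (G \<nu> l)) = (if k = l then 1 else 0)"
  obtains a where
    "\<And>p. p \<in> I \<Longrightarrow> cmod (\<Sum>l<n. F p l * a l) \<le> 2 * D * ln (12 * real K * (3 / 2 * real n + 1))"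
    "(real n - real t) / 2 - 1 \<le>
       (\<Sum>\<nu><n. (cmod (\<Sum>l<n. G \<nu> l * a l))\<^sup>2 - (cmod (\<Sum>l<n. G \<nu> l * a l)) ^ 4 / 6)"
proof -
  define R where "R = residual n t w"
  define x where "x p e = sgnsum n (R (F p)) e" for p e
  define z where "z \<nu> e = sgnsum n (R (G \<nu>)) e" for \<nu> e
  define E where "E p e = exp (Re (x p e) / D) + exp (- (Re (x p e) / D)) +
      exp (Im (x p e) / D) + exp (- (Im (x p e) / D))" for p e
  define \<Phi> where "\<Phi> e = (\<Sum>\<nu><n. (cmod (z \<nu> e))\<^sup>2 - cmod (z \<nu> e) ^ 4 / 6)" for e
  \<comment> \<open>Each \<open>E p\<close> is a sum of four exponentials of mean at most 3, and
    there are at most \<open>K\<close> of them; with this weight the penalty has mean at most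
    1.\<close>
  define H where "H e = \<Phi> e - 1 / (12 * real K) * (\<Sum>p\<in>I. E p e)" for e
  have sR: "sqnorm n (R f) = sqnorm n f - (\<Sum>j<t. (cmod (ip n f (w j)))\<^sup>2)" for f
    unfolding R_def by (rule sqnorm_residual[OF on])
  \<comment> \<open>The sum is the trace of the projection off \<open>w\<close>: by Parseval for the
    unitary \<open>G\<close>, each \<open>w j\<close> removes exactly 1 from
    \<open>n\<close>.\<close>
  have "(\<Sum>\<nu><n. sqnorm n (R (G \<nu>))) = (\<Sum>\<nu><n. 1 - (\<Sum>j<t. (cmod (ip n (G \<nu>) (w j)))\<^sup>2))"
    by (intro sum.cong refl) (simp add: sR G1)
  also have "\<dots> = real n - (\<Sum>\<nu><n. \<Sum>j<t. (cmod (ip n (G \<nu>) (w j)))\<^sup>2)"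
    by (simp add: sum_subtractf)
  also have "(\<Sum>\<nu><n. \<Sum>j<t. (cmod (ip n (G \<nu>) (w j)))\<^sup>2) =
      (\<Sum>j<t. \<Sum>\<nu><n. (cmod (ip n (G \<nu>) (w j)))\<^sup>2)" by (rule sum.swap)
  also have "\<dots> = (\<Sum>j<t. sqnorm n (w j))"
    by (intro sum.cong refl parseval G2)
  also have "\<dots> = (\<Sum>j<t. 1)"
  proof (intro sum.cong refl)
    fix j assume "j \<in> {..<t}"
    then have "complex_of_real (sqnorm n (w j)) = of_real 1"
      using on unfolding ip_self[symmetric] orthonormal_def by simp
    then show "sqnorm n (w j) = 1" unfolding of_real_eq_iff .
  qed
  finally have trace: "(\<Sum>\<nu><n. sqnorm n (R (G \<nu>))) = real n - real t" by simp
  have "0 \<le> (\<Sum>\<nu><n. sqnorm n (R (G \<nu>)))" by (intro sum_nonneg) simp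
  then have tn: "real t \<le> real n" using trace by simp
  have \<Phi>: "(real n - real t) / 2 \<le> avg n \<Phi>"
  proof -
    have "(real n - real t) / 2 = (\<Sum>\<nu><n. sqnorm n (R (G \<nu>)) / 2)"
      by (simp add: trace sum_divide_distrib[symmetric])
    also have "\<dots> \<le> (\<Sum>\<nu><n. avg n (\<lambda>e. (cmod (z \<nu> e))\<^sup>2 - 1 / 6 * cmod (z \<nu> e) ^ 4))"
    proof (intro sum_mono)
      fix \<nu> assume "\<nu> \<in> {..<n}"
      \<comment> \<open>The mean is at least s - 3 s^2 / 6, and this is at least s / 2 because s
        \<le> 1. The divisor 6 is chosen to match the constant 3 of the fourth moment.\<close>
      define s where "s = sqnorm n (R (G \<nu>))"
      have "0 \<le> s" by (simp add: s_def)
      moreover have "s \<le> 1"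
        using sR[of "G \<nu>"] G1[of \<nu>] \<open>\<nu> \<in> {..<n}\<close> unfolding s_def
        by (simp add: sum_nonneg)
      ultimately have "s\<^sup>2 \<le> s" by (simp add: power2_eq_square mult_left_le)
      moreover have "avg n (\<lambda>e. cmod (z \<nu> e) ^ 4) \<le> 3 * s\<^sup>2"
        unfolding z_def s_def by (rule avg_sgnsum_fourth_power)
      ultimately show "sqnorm n (R (G \<nu>)) / 2 \<le>
          avg n (\<lambda>e. (cmod (z \<nu> e))\<^sup>2 - 1 / 6 * cmod (z \<nu> e) ^ 4)"
        unfolding avg_diff avg_cmult unfolding z_def avg_sgnsum_square s_def by simp
    qed
    also have "\<dots> = avg n \<Phi>"
      unfolding \<Phi>_def by (subst avg_sum) simp_all
    finally show ?thesis .
  qed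
  have aE: "avg n (E p) \<le> 12" if "p \<in> I" for p
  proof -
    have e: "avg n (\<lambda>e. exp (\<Sum>j<n. c j * e j)) \<le> 3"
      if c: "\<And>j. (c j)\<^sup>2 \<le> (cmod (R (F p) j))\<^sup>2 / D\<^sup>2" for c
    proof -
      have "(\<Sum>j<n. (c j)\<^sup>2) \<le> (\<Sum>j<n. (cmod (R (F p) j))\<^sup>2 / D\<^sup>2)"
        by (intro sum_mono c)
      also have "\<dots> = sqnorm n (R (F p)) / D\<^sup>2"
        by (simp add: sqnorm_def sum_divide_distrib)
      also have "\<dots> \<le> 1" using F[OF \<open>p \<in> I\<close>] D by (simp add: R_def)
      finally have "exp (\<Sum>j<n. (c j)\<^sup>2) \<le> exp 1" by simp
      also have "\<dots> \<le> 3" by (rule exp_le)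
      finally show ?thesis using avg_exp_le[of n c] by linarith
    qed
    have re: "Re (x p e) / D = (\<Sum>j<n. Re (R (F p) j) / D * e j)"
      and im: "Im (x p e) / D = (\<Sum>j<n. Im (R (F p) j) / D * e j)" for e
      by (simp_all add: x_def sgnsum_def sum_divide_distrib)
    have re': "- (Re (x p e) / D) = (\<Sum>j<n. - (Re (R (F p) j) / D) * e j)"
      and im': "- (Im (x p e) / D) = (\<Sum>j<n. - (Im (R (F p) j) / D) * e j)" for e
      unfolding re im by (simp_all add: sum_negf)
    have le: "(Re u / D)\<^sup>2 \<le> (cmod u)\<^sup>2 / D\<^sup>2" "(Im u / D)\<^sup>2 \<le> (cmod u)\<^sup>2 / D\<^sup>2" for u
      by (simp_all add: power_divide cmod_power2 divide_right_mono)
    have "avg n (\<lambda>e. exp (Re (x p e) / D)) \<le> 3" "avg n (\<lambda>e. exp (- (Re (x p e) / D))) \<le> 3"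
      "avg n (\<lambda>e. exp (Im (x p e) / D)) \<le> 3" "avg n (\<lambda>e. exp (- (Im (x p e) / D))) \<le> 3"
      unfolding re' im' unfolding re im by (rule e, simp only: power2_minus le)+
    then show ?thesis unfolding E_def avg_add by linarith
  qed
  have "(real n - real t) / 2 - 1 \<le> avg n H"
  proof -
    have "(\<Sum>p\<in>I. avg n (E p)) \<le> (\<Sum>p\<in>I. 12)" by (intro sum_mono aE)
    also have "\<dots> \<le> 12 * real K" using I by simp
    finally have "1 / (12 * real K) * (\<Sum>p\<in>I. avg n (E p)) \<le> 1"
      using I by (simp add: field_simps)
    moreover have "avg n H = avg n \<Phi> - 1 / (12 * real K) * (\<Sum>p\<in>I. avg n (E p))"
      unfolding H_def avg_diff avg_cmult avg_sum[OF I(1)] ..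
    ultimately show ?thesis using \<Phi> by argo
  qed
  then obtain e where He: "(real n - real t) / 2 - 1 \<le> H e"
    using avg_le_value[of n H] order_trans by blast
  have Epos: "0 \<le> E p e" for p
    unfolding E_def by (intro add_nonneg_nonneg) simp_all
  have sE: "0 \<le> (\<Sum>p\<in>I. E p e)" by (intro sum_nonneg Epos)
  have \<Phi>e: "\<Phi> e \<le> 3 / 2 * real n"
  proof -
    have "\<Phi> e \<le> (\<Sum>\<nu><n. 3 / 2)" unfolding \<Phi>_def by (intro sum_mono square_sub_fourth_power_le)
    then show ?thesis by simp
  qed
  \<comment> \<open>Since \<open>H e\<close> is at least -1 and \<open>\<Phi> e\<close> at most
    3n/2, the weighted penalty is at most 3n/2 + 1. As the penalty is exponential in the forms, this
    polynomial bound costs them only a logarithmic factor.\<close>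
  have sE2: "(\<Sum>p\<in>I. E p e) \<le> 12 * real K * (3 / 2 * real n + 1)"
  proof -
    have "1 / (12 * real K) * (\<Sum>p\<in>I. E p e) \<le> 3 / 2 * real n + 1"
      using He \<Phi>e tn unfolding H_def by argo
    then show ?thesis using I by (simp add: field_simps)
  qed
  define M where "M = 12 * real K * (3 / 2 * real n + 1)"
  show thesis
  proof (rule that[of "project n t w e"])
    fix p assume p: "p \<in> I"
    have "E p e \<le> M"
      using member_le_sum[of p I "\<lambda>p. E p e"] p I Epos sE2 unfolding M_def by fastforce
    then have "exp (Re (x p e) / D) \<le> M" "exp (- (Re (x p e) / D)) \<le> M"
      "exp (Im (x p e) / D) \<le> M" "exp (- (Im (x p e) / D)) \<le> M"
      unfolding E_def by (smt (verit) exp_gt_zero)+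
    then have "\<bar>Re (x p e) / D\<bar> \<le> ln M" "\<bar>Im (x p e) / D\<bar> \<le> ln M"
      using abs_le_ln_if_exp_le by blast+
    then have "\<bar>Re (x p e)\<bar> \<le> D * ln M" "\<bar>Im (x p e)\<bar> \<le> D * ln M"
      using D by (simp_all add: abs_divide field_simps)
    then have "cmod (x p e) \<le> 2 * D * ln M" using cmod_le[of "x p e"] by simp
    then show "cmod (\<Sum>l<n. F p l * project n t w e l) \<le>
        2 * D * ln (12 * real K * (3 / 2 * real n + 1))"
      unfolding sum_project x_def R_def M_def .
  next
    have "H e \<le> \<Phi> e" using sE I by (simp add: H_def)
    then have "(real n - real t) / 2 - 1 \<le> \<Phi> e" using He by simp
    then show "(real n - real t) / 2 - 1 \<le> (\<Sum>\<nu><n. (cmod (\<Sum>l<n. G \<nu> l * project n t w e l))\<^sup>2 -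
        (cmod (\<Sum>l<n. G \<nu> l * project n t w e l)) ^ 4 / 6)"
      unfolding sum_project \<Phi>_def z_def R_def .
  qed
qed

section \<open>Circulant matrices\<close>

text \<open>The discrete Fourier matrix, scaled to be unitary; it is symmetric, so row and column
  statements are interchangeable.\<close>

definition fourier :: "nat \<Rightarrow> nat \<Rightarrow> nat \<Rightarrow> complex" where
  "fourier n \<nu> l = cis (2 * pi / real n) ^ (\<nu> * l) / of_real (sqrt (real n))"

lemma fourier_commute: "fourier n \<nu> l = fourier n l \<nu>"
  by (simp add: fourier_def mult.commute)

lemma cis_root_power_n: "0 < n \<Longrightarrow> cis (2 * pi / real n) ^ n = 1"
  by (simp add: Complex.DeMoivre)

lemma cis_root_power_mod:
  assumes "0 < n"
  shows "cis (2 * pi / real n) ^ (\<nu> * (k mod n)) = cis (2 * pi / real n) ^ (\<nu> * k)"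
proof -
  let ?w = "cis (2 * pi / real n)"
  have "?w ^ (\<nu> * k) = ?w ^ (\<nu> * (k mod n + n * (k div n)))" by simp
  also have "\<dots> = ?w ^ (\<nu> * (k mod n)) * (?w ^ n) ^ (\<nu> * (k div n))"
    by (simp only: power_mult[symmetric] power_add[symmetric] distrib_left mult_ac)
  finally show ?thesis using cis_root_power_n[OF assms] by simp
qed

lemma cis_root_power_neq_1:
  assumes "0 < d" "d < n"
  shows "cis (2 * pi / real n) ^ d \<noteq> 1"
proof
  assume "cis (2 * pi / real n) ^ d = 1"
  then have "cis (2 * pi * (real d / real n)) = 1"
    by (simp add: Complex.DeMoivre mult.commute)
  then have "cos (2 * pi * (real d / real n)) = 1" by (simp add: complex_eq_iff)
  then obtain m :: int where "2 * pi * (real d / real n) = real_of_int m * 2 * pi"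
    unfolding cos_one_2pi_int by blast
  then have "(2 * pi) * (real d / real n) = (2 * pi) * real_of_int m" by (simp only: mult_ac)
  then have "real d / real n = real_of_int m" unfolding mult_cancel_left by simp
  moreover have "0 < real d / real n" "real d / real n < 1" using assms by auto
  ultimately show False by simp
qed

text \<open>For \<open>k \<noteq> l\<close> this is a geometric sum whose ratio \<open>q\<close> is
  an n-th root of unity different from 1.\<close>

lemma fourier_orthogonal:
  assumes "k < n" "l < n"
  shows "(\<Sum>\<nu><n. fourier n \<nu> k * cnj (fourier n \<nu> l)) = (if k = l then 1 else 0)"
proof -
  let ?w = "cis (2 * pi / real n)"
  have n: "0 < n" using assms by simp
  define q where "q = ?w ^ k * cnj (?w ^ l)"
  have sq: "complex_of_real (sqrt (real n)) * of_real (sqrt (real n)) = of_nat n"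
    by (simp flip: of_real_mult)
  have "(\<Sum>\<nu><n. fourier n \<nu> k * cnj (fourier n \<nu> l)) = (\<Sum>\<nu><n. q ^ \<nu>) / of_nat n"
    unfolding fourier_def sum_divide_distrib q_def
    by (intro sum.cong refl) (simp add: sq power_mult_distrib power_mult[symmetric] mult.commute)
  moreover have unit: "?w ^ j * cnj (?w ^ j) = 1" for j
    by (simp add: complex_norm_square[symmetric] norm_power del: complex_cnj_power)
  moreover have "(\<Sum>\<nu><n. q ^ \<nu>) = 0" if "k \<noteq> l"
  proof -
    have "q \<noteq> 1"
    proof
      assume "q = 1"
      then have "?w ^ k * (?w ^ l * cnj (?w ^ l)) = ?w ^ l" unfolding q_def by (simp add: mult_ac)
      then have eq: "?w ^ k = ?w ^ l" unfolding unit by simp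
      show False
      proof (cases "k < l")
        case True
        then have "?w ^ k * ?w ^ (l - k) = ?w ^ l" by (simp flip: power_add)
        then have "?w ^ (l - k) = 1" unfolding eq by simp
        then show False using cis_root_power_neq_1[of "l - k" n] True assms by simp
      next
        case False
        then have "?w ^ l * ?w ^ (k - l) = ?w ^ k" by (simp flip: power_add)
        then have "?w ^ (k - l) = 1" unfolding eq by simp
        then show False using cis_root_power_neq_1[of "k - l" n] False that assms by simp
      qed
    qed
    moreover have "q ^ n = (?w ^ n) ^ k * cnj ((?w ^ n) ^ l)"
      by (simp add: q_def power_mult_distrib power_mult[symmetric] mult.commute)
    ultimately show ?thesis using cis_root_power_n[OF n] by (simp add: sum_gp_strict)
  qed
  ultimately show ?thesis using n by (auto simp: q_def)
qed

lemma sqnorm_fourier: "\<nu> < n \<Longrightarrow> sqnorm n (fourier n \<nu>) = 1"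
proof -
  assume "\<nu> < n"
  then have "ip n (fourier n \<nu>) (fourier n \<nu>) = 1"
    using fourier_orthogonal[of \<nu> n \<nu>] by (simp add: ip_def fourier_commute[of n \<nu>])
  then show ?thesis unfolding ip_self by (metis of_real_1 of_real_eq_iff)
qed

text \<open>The matrix of the convolution with \<open>g\<close>. Adding \<open>n\<close> keeps the
  natural subtraction exact for column indices below \<open>n\<close>.\<close>

definition circulant :: "nat \<Rightarrow> (nat \<Rightarrow> complex) \<Rightarrow> nat \<Rightarrow> nat \<Rightarrow> complex" where
  "circulant n g k l = g ((k + n - l) mod n)"

lemma bij_betw_cyclic_sub:
  fixes k n :: nat
  assumes "k < n"
  shows "bij_betw (\<lambda>l. (k + n - l) mod n) {..<n} {..<n}"
proof (rule bij_betw_byWitness[where f' = "\<lambda>l. (k + n - l) mod n"])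
  have "(k + n - (k + n - l) mod n) mod n = l" if "l < n" for l
  proof (cases "l \<le> k")
    case True
    then have "k + n - l = (k - l) + n" "k + n - (k - l) = l + n" by arith+
    then show ?thesis using that assms by (simp only: mod_add_self2 mod_less less_imp_diff_less)
  next
    case False
    then have "k + n - l < n" "k + n - (k + n - l) = l" using that by arith+
    then show ?thesis using that by (simp only: mod_less)
  qed
  then show "\<forall>l\<in>{..<n}. (k + n - (k + n - l) mod n) mod n = l"
    "\<forall>l\<in>{..<n}. (k + n - (k + n - l) mod n) mod n = l" by auto
qed (use assms in auto)

lemma sqnorm_circulant:
  assumes "k < n"
  shows "sqnorm n (circulant n g k) = sqnorm n g"
  unfolding sqnorm_def circulant_def
  by (rule sum.reindex_bij_betw[OF bij_betw_cyclic_sub[OF assms], of "\<lambda>l. (cmod (g l))\<^sup>2"])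

text \<open>Substituting the cyclic difference \<open>k - l\<close> for \<open>l\<close> factors out
  the character; the eigenvalue is the unnormalized Fourier coefficient of \<open>g\<close>, hence
  the factor \<open>sqrt n\<close>.\<close>

lemma circulant_eigenvector:
  assumes "k < n"
  shows "(\<Sum>l<n. circulant n g k l * cnj (fourier n \<nu> l)) =
      cnj (fourier n \<nu> k) * (\<Sum>l<n. of_real (sqrt (real n)) * fourier n \<nu> l * g l)"
proof -
  let ?w = "cis (2 * pi / real n)" and ?s = "complex_of_real (sqrt (real n))"
  have n: "0 < n" using assms by simp
  have "circulant n g k l * cnj (fourier n \<nu> l) =
      cnj (fourier n \<nu> k) * (?w ^ (\<nu> * ((k + n - l) mod n)) * g ((k + n - l) mod n))"
    if "l < n" for l
  proof -
    have "?w ^ (\<nu> * k) = ?w ^ (\<nu> * ((k + n) mod n))" using assms by simp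
    also have "\<dots> = ?w ^ (\<nu> * (k + n - l)) * ?w ^ (\<nu> * l)"
      unfolding cis_root_power_mod[OF n] using that
      by (simp flip: power_add distrib_left)
    also have "\<dots> = ?w ^ (\<nu> * ((k + n - l) mod n)) * ?w ^ (\<nu> * l)"
      unfolding cis_root_power_mod[OF n] ..
    finally have k: "?w ^ (\<nu> * k) = ?w ^ (\<nu> * ((k + n - l) mod n)) * ?w ^ (\<nu> * l)" .
    have "x * cnj x = 1" if "cmod x = 1" for x
      using that complex_norm_square[of x] by simp
    from this[of "?w ^ (\<nu> * ((k + n - l) mod n))"]
    have "cnj (?w ^ (\<nu> * l)) = cnj (?w ^ (\<nu> * k)) * ?w ^ (\<nu> * ((k + n - l) mod n))"
      unfolding k by (simp add: norm_power mult_ac)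
    then show ?thesis by (simp add: circulant_def fourier_def)
  qed
  then have "(\<Sum>l<n. circulant n g k l * cnj (fourier n \<nu> l)) =
      cnj (fourier n \<nu> k) * (\<Sum>l<n. ?w ^ (\<nu> * ((k + n - l) mod n)) * g ((k + n - l) mod n))"
    by (simp add: sum_distrib_left)
  also have "(\<Sum>l<n. ?w ^ (\<nu> * ((k + n - l) mod n)) * g ((k + n - l) mod n)) =
      (\<Sum>l<n. ?w ^ (\<nu> * l) * g l)"
    by (rule sum.reindex_bij_betw[OF bij_betw_cyclic_sub[OF assms], of "\<lambda>l. ?w ^ (\<nu> * l) * g l"])
  also have "\<dots> = (\<Sum>l<n. ?s * fourier n \<nu> l * g l)"
    using n by (intro sum.cong) (auto simp: fourier_def)
  finally show ?thesis .
qed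

text \<open>The conjugate Fourier matrix diagonalizes every circulant. Its determinant can be
  cancelled because multiplying it by that of the Fourier matrix gives 1.\<close>

lemma minor_circulant:
  "minor n (circulant n g) = (\<Prod>\<nu><n. \<Sum>l<n. of_real (sqrt (real n)) * fourier n \<nu> l * g l)"
proof -
  let ?e = "\<lambda>\<nu>. \<Sum>l<n. of_real (sqrt (real n)) * fourier n \<nu> l * g l"
  let ?F = "\<lambda>l \<nu>. cnj (fourier n \<nu> l)"
  have "minor n (circulant n g) * minor n ?F = minor n (\<lambda>k \<nu>. \<Sum>l<n. circulant n g k l * ?F l \<nu>)"
    by (rule minor_mult[symmetric])
  also have "\<dots> = minor n (\<lambda>k \<nu>. \<Sum>\<mu><n. ?F k \<mu> * (if \<mu> = \<nu> then ?e \<nu> else 0))"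
    by (rule minor_cong) (simp add: circulant_eigenvector if_distrib cong: if_cong)
  also have "\<dots> = minor n ?F * minor n (\<lambda>\<mu> \<nu>. if \<mu> = \<nu> then ?e \<nu> else 0)"
    by (rule minor_mult)
  also have "minor n (\<lambda>\<mu> \<nu>. if \<mu> = \<nu> then ?e \<nu> else 0) = (\<Prod>\<nu><n. ?e \<nu>)"
    by (subst minor_triangular) auto
  finally have eq: "minor n (circulant n g) * minor n ?F = minor n ?F * (\<Prod>\<nu><n. ?e \<nu>)" .
  have "minor n (\<lambda>l \<nu>. fourier n l \<nu>) * minor n ?F =
      minor n (\<lambda>k l. \<Sum>\<nu><n. fourier n k \<nu> * cnj (fourier n l \<nu>))"
    by (rule minor_mult[symmetric])
  also have "\<dots> = minor n (\<lambda>k l. if k = l then 1 else 0)"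
  proof (rule minor_cong)
    fix k l assume "k < n" "l < n"
    then show "(\<Sum>\<nu><n. fourier n k \<nu> * cnj (fourier n l \<nu>)) = (if k = l then 1 else 0)"
      using fourier_orthogonal[of k n l] by (simp only: fourier_commute[of n k] fourier_commute[of n l])
  qed
  also have "\<dots> = 1" by (subst minor_triangular) auto
  finally have "minor n ?F \<noteq> 0" by auto
  with eq show ?thesis by simp
qed

text \<open>\<open>h\<close> is the inverse Fourier transform of the prescribed eigenvalues;
  Parseval gives its norm as n terms 1 / n.\<close>

lemma exists_unimodular_circulant:
  assumes "0 < n" and \<theta>: "\<And>\<nu>. \<nu> < n \<Longrightarrow> cmod (\<theta> \<nu>) = 1"
  obtains h where "sqnorm n h = 1"
    "\<And>\<nu>. \<nu> < n \<Longrightarrow> (\<Sum>l<n. of_real (sqrt (real n)) * fourier n \<nu> l * h l) = \<theta> \<nu>"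
proof -
  let ?s = "complex_of_real (sqrt (real n))"
  define h where "h l = (\<Sum>\<nu><n. \<theta> \<nu> * cnj (fourier n \<nu> l)) / ?s" for l
  have s: "?s \<noteq> 0" using assms by simp
  have hh: "(\<Sum>l<n. fourier n \<nu> l * h l) = \<theta> \<nu> / ?s" if "\<nu> < n" for \<nu>
  proof -
    have "(\<Sum>l<n. fourier n \<nu> l * h l) =
        (\<Sum>l<n. \<Sum>\<mu><n. \<theta> \<mu> * (fourier n l \<nu> * cnj (fourier n l \<mu>))) / ?s"
      by (simp add: h_def sum_distrib_left sum_divide_distrib mult_ac fourier_commute[of n \<nu>]
          fourier_commute[of n "_ :: nat"])
    also have "(\<Sum>l<n. \<Sum>\<mu><n. \<theta> \<mu> * (fourier n l \<nu> * cnj (fourier n l \<mu>))) =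
        (\<Sum>\<mu><n. \<theta> \<mu> * (\<Sum>l<n. fourier n l \<nu> * cnj (fourier n l \<mu>)))"
      by (subst sum.swap) (simp add: sum_distrib_left)
    also have "\<dots> = (\<Sum>\<mu><n. if \<nu> = \<mu> then \<theta> \<mu> else 0)"
      using that by (intro sum.cong refl) (simp add: fourier_orthogonal)
    finally show ?thesis using that by simp
  qed
  show thesis
  proof (rule that[of h])
    have "sqnorm n h = sqnorm n (\<lambda>l. cnj (h l))" by (simp add: sqnorm_def)
    also have "\<dots> = (\<Sum>\<nu><n. (cmod (ip n (fourier n \<nu>) (\<lambda>l. cnj (h l))))\<^sup>2)"
      by (rule parseval[symmetric]) (rule fourier_orthogonal)
    also have "\<dots> = (\<Sum>\<nu><n. 1 / real n)"
      by (intro sum.cong refl) (simp add: ip_def hh \<theta> norm_divide power_divide)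
    finally show "sqnorm n h = 1" using assms by simp
  next
    fix \<nu> assume "\<nu> < n"
    then show "(\<Sum>l<n. ?s * fourier n \<nu> l * h l) = \<theta> \<nu>"
      using hh s by (simp add: mult.assoc sum_distrib_left[symmetric])
  qed
qed

lemma bc_span_add_rows:
  assumes V: "bc_span V0 s V" and C: "\<And>k. k < m \<Longrightarrow> C k \<in> V" and H: "\<And>k. k < m \<Longrightarrow> H k \<in> V0"
  shows "\<exists>V'. bc_span V0 (s + m) V' \<and> V \<subseteq> V' \<and> (\<forall>k<m. (\<lambda>l. C k l + H k l) \<in> V')"
  using C H
proof (induction m)
  case 0
  then show ?case using V by auto
next
  case (Suc m)
  then obtain V' where V': "bc_span V0 (s + m) V'" "V \<subseteq> V'" "\<forall>k<m. (\<lambda>l. C k l + H k l) \<in> V'"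
    by auto
  have "C m \<in> V'" "H m \<in> V'"
    using Suc.prems V' bc_span_mono[OF V'(1)] by auto
  from bc_span.step[OF V'(1) this, of 1 1]
  have "bc_span V0 (s + Suc m) (insert (\<lambda>l. C m l + H m l) V')" by simp
  moreover have "\<forall>k<Suc m. (\<lambda>l. C k l + H k l) \<in> insert (\<lambda>l. C m l + H m l) V'"
    using V'(3) by (auto simp: less_Suc_eq)
  ultimately show ?case using V'(2) by (intro exI[of _ "insert (\<lambda>l. C m l + H m l) V'"]) auto
qed

text \<open>
  Adding to a circulant matrix a unitary circulant matrix whose eigenvalues have the same phases
  makes the determinant large even if some of the eigenvalues vanish.
\<close>

lemma circulant_cost:
  assumes n: "0 < n" and B: "0 < B"
  obtains H where "\<And>s V C. bc_span (unit_vector ` {..<n} \<union> H ` {..<n}) s V \<Longrightarrow>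
    (\<And>k. k < n \<Longrightarrow> C k \<in> V) \<Longrightarrow>
    (\<And>k l. k < n \<Longrightarrow> l < n \<Longrightarrow> C k l = circulant n a k l / of_real B) \<Longrightarrow>
    (\<Prod>\<nu><n. 1 + sqrt (real n) * cmod (\<Sum>l<n. fourier n \<nu> l * a l) / B) \<le> 2 ^ (s + n)"
proof -
  let ?s = "complex_of_real (sqrt (real n))"
  define y where "y \<nu> = (\<Sum>l<n. ?s * fourier n \<nu> l * (a l / of_real B))" for \<nu>
  \<comment> \<open>The value 1 for a vanishing eigenvalue keeps \<open>\<theta> \<nu>\<close>
    unimodular, so that \<open>\<theta> \<nu>\<close> always lengthens \<open>y \<nu>\<close> by
    exactly 1.\<close>
  define \<theta> where "\<theta> \<nu> = (if y \<nu> = 0 then 1 else sgn (y \<nu>))" for \<nu>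
  have \<theta>: "cmod (\<theta> \<nu>) = 1" "cmod (y \<nu> + \<theta> \<nu>) = cmod (y \<nu>) + 1" for \<nu>
  proof -
    show "cmod (\<theta> \<nu>) = 1" by (simp add: \<theta>_def norm_sgn)
    show "cmod (y \<nu> + \<theta> \<nu>) = cmod (y \<nu>) + 1"
    proof (cases "y \<nu> = 0")
      case False
      have "y \<nu> + \<theta> \<nu> = of_real (cmod (y \<nu>) + 1) * sgn (y \<nu>)"
        using False by (simp add: \<theta>_def sgn_eq field_simps)
      then have "cmod (y \<nu> + \<theta> \<nu>) = \<bar>cmod (y \<nu>) + 1\<bar> * 1"
        using False by (simp only: norm_mult norm_of_real norm_sgn) simp
      then show ?thesis by simp
    qed (simp add: \<theta>_def)
  qed
  obtain h where h: "sqnorm n h = 1"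
    "\<And>\<nu>. \<nu> < n \<Longrightarrow> (\<Sum>l<n. ?s * fourier n \<nu> l * h l) = \<theta> \<nu>"
    using exists_unimodular_circulant[OF n, of \<theta>] \<theta>(1) by metis
  show thesis
  proof (rule that[of "circulant n h"])
    fix s V C
    assume V: "bc_span (unit_vector ` {..<n} \<union> circulant n h ` {..<n}) s V"
      and CV: "\<And>k. k < n \<Longrightarrow> C k \<in> V"
      and C: "\<And>k l. k < n \<Longrightarrow> l < n \<Longrightarrow> C k l = circulant n a k l / of_real B"
    obtain V' where V': "bc_span (unit_vector ` {..<n} \<union> circulant n h ` {..<n}) (s + n) V'"
      "\<forall>k<n. (\<lambda>l. C k l + circulant n h k l) \<in> V'"
      using bc_span_add_rows[OF V, of n C "circulant n h"] CV by blast
    \<comment> \<open>All rows of the circulant of \<open>h\<close> have norm 1, so admitting them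
      as additional inputs does not raise the initial Hadamard bound.\<close>
    have "minors_bounded n (unit_vector ` {..<n} \<union> circulant n h ` {..<n}) 1"
      unfolding minors_bounded_def
      by (intro allI impI hadamard_inequality) (auto dest!: spec simp: sqnorm_unit_vector sqnorm_circulant h)
    from minors_bounded_bc_span[OF V'(1) this] V'(2)
    have le: "cmod (minor n (\<lambda>k l. C k l + circulant n h k l)) \<le> 2 ^ (s + n)"
      by (simp add: minors_bounded_def)
    have "minor n (\<lambda>k l. C k l + circulant n h k l) =
        minor n (circulant n (\<lambda>l. a l / of_real B + h l))"
      by (rule minor_cong) (simp add: C circulant_def)
    also have "\<dots> = (\<Prod>\<nu><n. y \<nu> + \<theta> \<nu>)"
      unfolding minor_circulant
      by (intro prod.cong refl) (simp add: h(2)[symmetric] y_def sum.distrib[symmetric] algebra_simps)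
    finally have "cmod (minor n (\<lambda>k l. C k l + circulant n h k l)) = (\<Prod>\<nu><n. 1 + cmod (y \<nu>))"
      by (simp add: prod_norm[symmetric] \<theta>(2)) (simp add: add.commute)
    moreover have "cmod (y \<nu>) = sqrt (real n) * cmod (\<Sum>l<n. fourier n \<nu> l * a l) / B" for \<nu>
    proof -
      have "y \<nu> = ?s * (\<Sum>l<n. fourier n \<nu> l * a l) / of_real B"
        by (simp add: y_def sum_distrib_left sum_divide_distrib mult.assoc)
      then show ?thesis using B by (simp add: norm_mult norm_divide)
    qed
    ultimately show "(\<Prod>\<nu><n. 1 + sqrt (real n) * cmod (\<Sum>l<n. fourier n \<nu> l * a l) / B) \<le> 2 ^ (s + n)"
      using le by simp
  qed
qed

section \<open>Circuits\<close>

lemma run_snoc: "run N (P @ [c]) x = run N P x @ [result (run N P x) c]"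
  by (simp add: run_def)

lemma length_run [simp]: "length (run N P x) = N + length P"
  by (induction P rule: rev_induct) (simp_all add: run_snoc, simp add: run_def)

lemma nth_run_append: "p < N + length P \<Longrightarrow> run N (P @ Q) x ! p = run N P x ! p"
proof (induction Q rule: rev_induct)
  case (snoc c Q)
  then show ?case
    by (simp add: run_snoc nth_append flip: append_assoc)
qed simp

lemma nth_run_input: "p < N \<Longrightarrow> run N P x ! p = x p"
  using nth_run_append[of p N "[]" P x] by (simp add: run_def)

lemma result_cong: "(\<And>i. i \<in> operands c \<Longrightarrow> vs ! i = ws ! i) \<Longrightarrow> result vs c = result ws c"
  by (cases c) auto

lemma nth_run_instr:
  assumes P: "is_circuit N P" and t: "t < length P"
  shows "run N P x ! (N + t) = result (run N P x) (P ! t)"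
proof -
  have split: "P = (take t P @ [P ! t]) @ drop (Suc t) P"
    using t by (simp add: Cons_nth_drop_Suc)
  have "run N P x ! (N + t) = run N (take t P @ [P ! t]) x ! (N + t)"
    using nth_run_append[of "N + t" N "take t P @ [P ! t]" "drop (Suc t) P" x] t
    unfolding split[symmetric] by simp
  also have "\<dots> = result (run N (take t P) x) (P ! t)"
    using t by (simp add: run_snoc nth_append)
  also have "\<dots> = result (run N P x) (P ! t)"
  proof (rule result_cong)
    fix i assume "i \<in> operands (P ! t)"
    then have "i < N + t" using P t by (auto simp: is_circuit_def)
    then show "run N (take t P) x ! i = run N P x ! i"
      using nth_run_append[of i N "take t P" "drop t P" x] t by simp
  qed
  finally show ?thesis .
qed

section \<open>Linear parts of circuits and their coefficient vectors\<close>

lemma linear_part_induct: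
  assumes lin: "linear_part S q Q" and S: "\<And>p. p \<in> S \<Longrightarrow> Z p"
    and step: "\<And>t. t < length Q \<Longrightarrow> linear_instr (Q ! t) \<Longrightarrow>
      (\<And>p. p \<in> operands (Q ! t) \<Longrightarrow> Z p) \<Longrightarrow> Z (q + t)"
    and p: "p \<in> S \<union> {q..<q + length Q}"
  shows "Z p"
proof -
  have "t < length Q \<Longrightarrow> Z (q + t)" for t
  proof (induction t rule: less_induct)
    case (less t)
    show ?case
    proof (rule step)
      fix p assume "p \<in> operands (Q ! t)"
      then consider "p \<in> S" | u where "p = q + u" "u < t"
        using lin less.prems by (fastforce simp: linear_part_def dest!: le_Suc_ex)
      then show "Z p"
        using less S by cases auto
    qed (use lin less.prems in \<open>auto simp: linear_part_def\<close>)
  qed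
  moreover have "p \<in> S \<or> (\<exists>t<length Q. p = q + t)"
    using p by (auto dest!: le_Suc_ex)
  ultimately show ?thesis using S by auto
qed

text \<open>The coefficients are read off by running the circuit on unit vectors, so no symbolic
  linear forms are needed.\<close>

lemma linear_part_form:
  assumes lin: "linear_part S q Q" and S: "finite S" "S \<subseteq> {..<N}"
    and run: "\<And>t x. t < length Q \<Longrightarrow> run N P x ! (q + t) = result (run N P x) (Q ! t)"
    and p: "p \<in> S \<union> {q..<q + length Q}"
  shows "run N P x ! p = (\<Sum>l\<in>S. run N P (unit_vector l) ! p * x l)"
proof -
  let ?Z = "\<lambda>p. \<forall>x. run N P x ! p = (\<Sum>l\<in>S. run N P (unit_vector l) ! p * x l)"
  from lin have "?Z p"
  proof (rule linear_part_induct[OF _ _ _ p])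
    fix p assume "p \<in> S"
    then have "p < N" using S by auto
    then have "(\<Sum>l\<in>S. run N P (unit_vector l) ! p * x l) = (\<Sum>l\<in>S. if p = l then x l else 0)" for x
      by (intro sum.cong) (auto simp: nth_run_input unit_vector_def)
    then show "?Z p" using \<open>p \<in> S\<close> \<open>p < N\<close> S by (simp add: nth_run_input)
  next
    fix t assume t: "t < length Q" and li: "linear_instr (Q ! t)"
      and Z: "\<And>p. p \<in> operands (Q ! t) \<Longrightarrow> ?Z p"
    show "?Z (q + t)"
    proof (cases "Q ! t")
      case (Add i j)
      show ?thesis
      proof
        fix x
        have "run N P x ! i = (\<Sum>l\<in>S. run N P (unit_vector l) ! i * x l)"
          "run N P x ! j = (\<Sum>l\<in>S. run N P (unit_vector l) ! j * x l)"
          by (rule Z[rule_format], simp add: Add)+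
        then show "run N P x ! (q + t) = (\<Sum>l\<in>S. run N P (unit_vector l) ! (q + t) * x l)"
          by (simp add: run[OF t] Add sum.distrib distrib_right)
      qed
    next
      case (Sub i j)
      show ?thesis
      proof
        fix x
        have "run N P x ! i = (\<Sum>l\<in>S. run N P (unit_vector l) ! i * x l)"
          "run N P x ! j = (\<Sum>l\<in>S. run N P (unit_vector l) ! j * x l)"
          by (rule Z[rule_format], simp add: Sub)+
        then show "run N P x ! (q + t) = (\<Sum>l\<in>S. run N P (unit_vector l) ! (q + t) * x l)"
          by (simp add: run[OF t] Sub sum_subtractf left_diff_distrib)
      qed
    next
      case (Mult i j)
      then show ?thesis using li by simp
    next
      case (Scale c i)
      show ?thesis
      proof
        fix x
        have "run N P x ! i = (\<Sum>l\<in>S. run N P (unit_vector l) ! i * x l)"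
          by (rule Z[rule_format], simp add: Scale)
        then show "run N P x ! (q + t) = (\<Sum>l\<in>S. run N P (unit_vector l) ! (q + t) * x l)"
          by (simp add: run[OF t] Scale sum_distrib_left mult.assoc)
      qed
    qed
  qed
  then show ?thesis by blast
qed

text \<open>Every instruction is one \<open>step\<close>, with coefficients 1 and 1, 1 and -1, or
  \<open>c\<close> and 0. The vectors \<open>r p\<close> stay abstract because they will be
  coefficients in the first part, values after substitution in the second, and such values divided
  by \<open>B\<close> in the fourth.\<close>

lemma linear_part_bc_span:
  assumes V: "bc_span V0 s V" and S: "\<And>p. p \<in> S \<Longrightarrow> r p \<in> V"
    and lin: "linear_part S q Q" and bc: "bounded_coeff Q"
    and add: "\<And>t i j. t < length Q \<Longrightarrow> Q ! t = Add i j \<Longrightarrow> r (q + t) = (\<lambda>l. r i l + r j l)"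
    and sub: "\<And>t i j. t < length Q \<Longrightarrow> Q ! t = Sub i j \<Longrightarrow> r (q + t) = (\<lambda>l. r i l - r j l)"
    and scale: "\<And>t c i. t < length Q \<Longrightarrow> Q ! t = Scale c i \<Longrightarrow> r (q + t) = (\<lambda>l. c * r i l)"
  shows "\<exists>V'. bc_span V0 (s + length Q) V' \<and> V \<subseteq> V' \<and> (\<forall>p\<in>S \<union> {q..<q + length Q}. r p \<in> V')"
proof -
  have "m \<le> length Q \<Longrightarrow>
      \<exists>V'. bc_span V0 (s + m) V' \<and> V \<subseteq> V' \<and> (\<forall>p\<in>S \<union> {q..<q + m}. r p \<in> V')" for m
  proof (induction m)
    case 0
    then show ?case using V S by auto
  next
    case (Suc m)
    then have m: "m < length Q" by simp
    from Suc obtain V' where V': "bc_span V0 (s + m) V'" "V \<subseteq> V'"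
      and r: "\<And>p. p \<in> S \<union> {q..<q + m} \<Longrightarrow> r p \<in> V'" by auto
    have ops: "operands (Q ! m) \<subseteq> S \<union> {q..<q + m}" and li: "linear_instr (Q ! m)"
      using lin m by (auto simp: linear_part_def)
    have "bc_span V0 (Suc (s + m)) (insert (r (q + m)) V')"
    proof (cases "Q ! m")
      case (Add i j)
      then have "r i \<in> V'" "r j \<in> V'" using ops by (auto intro!: r)
      from bc_span.step[OF V'(1) this, of 1 1] show ?thesis by (simp add: add[OF m Add])
    next
      case (Sub i j)
      then have "r i \<in> V'" "r j \<in> V'" using ops by (auto intro!: r)
      from bc_span.step[OF V'(1) this, of 1 "-1"] show ?thesis by (simp add: sub[OF m Sub])
    next
      case (Mult i j)
      then show ?thesis using li by simp
    next
      case (Scale c i)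
      then have "r i \<in> V'" using ops by (auto intro!: r)
      moreover have "cmod c \<le> 2"
        using bc Scale m unfolding bounded_coeff_def by (metis nth_mem)
      ultimately show ?thesis
        using bc_span.step[OF V'(1), of "r i" "r i" c 0] by (simp add: scale[OF m Scale])
    qed
    moreover have "S \<union> {q..<q + Suc m} = insert (q + m) (S \<union> {q..<q + m})" by auto
    ultimately show ?case
      using V' r by (intro exI[of _ "insert (r (q + m)) V'"]) auto
  qed
  from this[of "length Q"] show ?thesis by simp
qed

lemma products_bc_span:
  fixes m :: nat
  assumes V: "bc_span V0 s V"
    and r: "\<And>t. t < m \<Longrightarrow> \<exists>a u. u \<in> V \<and> cmod a \<le> 1 \<and> r t = (\<lambda>l. a * u l)"
  shows "\<exists>V'. bc_span V0 s V' \<and> V \<subseteq> V' \<and> (\<forall>t<m. r t \<in> V')"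
  using r
proof (induction m)
  case 0
  then show ?case using V by auto
next
  case (Suc m)
  then obtain V' where V': "bc_span V0 s V'" "V \<subseteq> V'" "\<forall>t<m. r t \<in> V'" by auto
  obtain a u where "u \<in> V" "cmod a \<le> 1" "r m = (\<lambda>l. a * u l)" using Suc.prems by blast
  then have "bc_span V0 s (insert (r m) V')" using bc_span.shrink[OF V'(1)] V'(2) by auto
  then show ?case using V' by (intro exI[of _ "insert (r m) V'"]) (auto simp: less_Suc_eq)
qed

section \<open>From convolution circuits to circulant matrices\<close>

lemma conv_unit_vector:
  assumes "k < n" "l < n"
  shows "conv n a (unit_vector l) k = circulant n a k l"
proof -
  have iff: "(i + l) mod n = k \<longleftrightarrow> i = (k + n - l) mod n" if "i < n" for i
  proof
    assume k: "(i + l) mod n = k"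
    show "i = (k + n - l) mod n"
    proof (cases "i + l < n")
      case True
      then have "k + n - l = i + n" using k by simp
      then show ?thesis using that by simp
    next
      case False
      then have "(i + l) mod n = i + l - n" using that assms by (simp add: le_mod_geq)
      then have "k + n - l = i" using k False by simp
      then show ?thesis using that by simp
    qed
  next
    assume i: "i = (k + n - l) mod n"
    show "(i + l) mod n = k"
    proof (cases "l \<le> k")
      case True
      then have "k + n - l = (k - l) + n" by arith
      then have "i = k - l" using i assms by (simp only: mod_add_self2 mod_less less_imp_diff_less)
      then show ?thesis using True assms by simp
    next
      case False
      then have "i = k + n - l" using i assms by simp
      then show ?thesis using assms by simp
    qed
  qed
  have "conv n a (unit_vector l) k = (\<Sum>(i, j)\<in>{((k + n - l) mod n, l)}. a i * unit_vector l j)"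
    unfolding conv_def
  proof (rule sum.mono_neutral_right)
    show "finite {(i, j). i < n \<and> j < n \<and> (i + j) mod n = k mod n}"
      by (rule finite_subset[of _ "{..<n} \<times> {..<n}"]) auto
    show "{((k + n - l) mod n, l)} \<subseteq> {(i, j). i < n \<and> j < n \<and> (i + j) mod n = k mod n}"
      using iff[of "(k + n - l) mod n"] assms by simp
    show "\<forall>x\<in>{(i, j). i < n \<and> j < n \<and> (i + j) mod n = k mod n} - {((k + n - l) mod n, l)}.
        (case x of (i, j) \<Rightarrow> a i * unit_vector l j) = 0"
    proof
      fix x assume x: "x \<in> {(i, j). i < n \<and> j < n \<and> (i + j) mod n = k mod n} - {((k + n - l) mod n, l)}"
      obtain i j where ij: "x = (i, j)" by (cases x)
      have "i < n" "(i + j) mod n = k" "\<not> (i = (k + n - l) mod n \<and> j = l)"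
        using x ij assms by auto
      then have "j \<noteq> l" using iff[of i] by blast
      then show "(case x of (i, j) \<Rightarrow> a i * unit_vector l j) = 0" by (simp add: ij unit_vector_def)
    qed
  qed
  then show ?thesis by (simp add: circulant_def unit_vector_def)
qed

lemma conv_cong:
  assumes "\<And>i. i < n \<Longrightarrow> a i = a' i" "\<And>i. i < n \<Longrightarrow> b i = b' i"
  shows "conv n a b k = conv n a' b' k"
  unfolding conv_def using assms by (intro sum.cong) auto

text \<open>A form in one half of the variables does not notice when the other half is set to 0, but
  the convolution then drops from 1 to 0 at the chosen point. Hence no output lies in the first two
  parts.\<close>

lemma conv_output_position:
  assumes n: "0 < n" "k < n"
    and out: "\<And>x. v x = conv n x (\<lambda>j. x (n + j)) k"
    and A: "A \<subseteq> {..<n} \<or> A \<subseteq> {n..<n + n}"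
    and form: "\<And>x. v x = (\<Sum>l\<in>A. g l * x l)"
  shows False
proof -
  define x where "x p = (if p < n then 1 else unit_vector 0 (p - n))" for p
  have "v x = conv n (\<lambda>_. 1) (unit_vector 0) k"
    unfolding out by (rule conv_cong) (auto simp: x_def)
  then have 1: "v x = 1" using conv_unit_vector[of k n 0] n by (simp add: circulant_def)
  show False
  proof (cases "A \<subseteq> {..<n}")
    case True
    define y where "y p = (if p < n then 1 else 0 :: complex)" for p
    have "v x = v y"
      unfolding form using True by (intro sum.cong) (auto simp: x_def y_def)
    moreover have "v y = 0" unfolding out conv_def y_def by (intro sum.neutral) auto
    ultimately show ?thesis using 1 by simp
  next
    case False
    then have "A \<subseteq> {n..<n + n}" using A by simp
    define y where "y p = (if p < n then 0 else unit_vector 0 (p - n))" for p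
    have "v x = v y"
      unfolding form using \<open>A \<subseteq> {n..<n + n}\<close> by (intro sum.cong) (auto simp: x_def y_def)
    moreover have "v y = 0" unfolding out conv_def y_def by (intro sum.neutral) auto
    ultimately show ?thesis using 1 by simp
  qed
qed

text \<open>\<open>s1\<close> is the length of the first part, \<open>s2\<close> that of the second
  and fourth together, and \<open>z\<close> lists the moduli of the Fourier coefficients of the
  substituted input.\<close>

lemma conv_circuit_bound:
  assumes n: "0 < n" and bil: "bilinear_circuit n n P" and bc: "bounded_coeff P"
    and comp: "computes (n + n) P ((\<lambda>k x. conv n x (\<lambda>j. x (n + j)) k) ` {..<n})"
    and D: "1 < D"
  obtains s1 s2 t z where "s1 + s2 \<le> length P" "D ^ t \<le> 2 ^ s1" "\<And>\<nu>. 0 \<le> z \<nu>"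
    "(real n - real t) / 2 - 1 \<le> (\<Sum>\<nu><n. (z \<nu>)\<^sup>2 - z \<nu> ^ 4 / 6)"
    "(\<Prod>\<nu><n. 1 + sqrt (real n) * z \<nu> /
       (2 * D * ln (12 * real (n + s1) * (3 / 2 * real n + 1)))) \<le> 2 ^ (s2 + n)"
proof -
  obtain P1 P2 P3 P4 where P: "P = P1 @ P2 @ P3 @ P4" and
    bil': "let s1 = n + n; s2 = s1 + length P1; s3 = s2 + length P2; s4 = s3 + length P3 in
          linear_part {..<n} s1 P1 \<and>
          linear_part {n..<n + n} s2 P2 \<and>
          (\<forall>c\<in>set P3. \<exists>i\<in>{..<n} \<union> {s1..<s2}. \<exists>j\<in>{n..<n + n} \<union> {s2..<s3}. c = Mult i j) \<and>
          linear_part {s3..<s4} s4 P4"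
    using bil unfolding bilinear_circuit_def by blast
  define N where "N = n + n"
  define q2 where "q2 = N + length P1"
  define q3 where "q3 = q2 + length P2"
  define q4 where "q4 = q3 + length P3"
  have L1: "linear_part {..<n} N P1" and L2: "linear_part {n..<n + n} q2 P2"
    and L3: "\<And>c. c \<in> set P3 \<Longrightarrow> \<exists>i\<in>{..<n} \<union> {N..<q2}. \<exists>j\<in>{n..<n + n} \<union> {q2..<q3}. c = Mult i j"
    and L4: "linear_part {q3..<q4} q4 P4"
    using bil' unfolding Let_def N_def q2_def q3_def q4_def by auto
  have ic: "is_circuit N P" unfolding N_def by (rule bilinear_circuit_is_circuit[OF bil])
  have R1: "run N P x ! (N + t) = result (run N P x) (P1 ! t)" if "t < length P1" for x t
    using nth_run_instr[OF ic, of t x] that by (simp add: P nth_append)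
  have R2: "run N P x ! (q2 + t) = result (run N P x) (P2 ! t)" if "t < length P2" for x t
    using nth_run_instr[OF ic, of "length P1 + t" x] that by (simp add: P nth_append q2_def add.assoc)
  have R3: "run N P x ! (q3 + t) = result (run N P x) (P3 ! t)" if "t < length P3" for x t
    using nth_run_instr[OF ic, of "length P1 + length P2 + t" x] that
    by (simp add: P nth_append q3_def q2_def add.assoc)
  have R4: "run N P x ! (q4 + t) = result (run N P x) (P4 ! t)" if "t < length P4" for x t
    using nth_run_instr[OF ic, of "length P1 + length P2 + length P3 + t" x] that
    by (simp add: P nth_append q4_def q3_def q2_def add.assoc)
  have bc': "bounded_coeff P1" "bounded_coeff P2" "bounded_coeff P4"
    using bc unfolding bounded_coeff_def P by auto
  define I where "I = {..<n} \<union> {N..<N + length P1}"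
  define F where "F p = (\<lambda>l. run N P (unit_vector l) ! p)" for p
  have form1: "run N P x ! p = (\<Sum>l<n. F p l * x l)" if "p \<in> I" for x p
    unfolding F_def by (rule linear_part_form[OF L1 _ _ R1 that[unfolded I_def]]) (auto simp: N_def)
  have form2: "run N P x ! p = (\<Sum>l\<in>{n..<n + n}. F p l * x l)"
    if "p \<in> {n..<n + n} \<union> {q2..<q2 + length P2}" for x p
    unfolding F_def by (rule linear_part_form[OF L2 _ _ R2 that]) (auto simp: N_def)
  have F_in: "F p \<in> unit_vector ` {..<n}" if "p < n" for p
  proof -
    have "F p = unit_vector p"
      using that by (auto simp: F_def N_def nth_run_input unit_vector_def)
    then show ?thesis using that by auto
  qed
  have "\<exists>V'. bc_span (unit_vector ` {..<n}) (0 + length P1) V' \<and> unit_vector ` {..<n} \<subseteq> V' \<and>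
      (\<forall>p\<in>{..<n} \<union> {N..<N + length P1}. F p \<in> V')"
    by (rule linear_part_bc_span[OF bc_span.init _ L1 bc'(1)])
      (use F_in in \<open>auto simp: F_def R1\<close>)
  then obtain V1 where V1: "bc_span (unit_vector ` {..<n}) (length P1) V1" "\<forall>p\<in>I. F p \<in> V1"
    by (auto simp: I_def)
  obtain t w where on: "orthonormal n t w" and Dt: "D ^ t \<le> 2 ^ length P1"
    and res: "\<And>f. f \<in> V1 \<Longrightarrow> sqnorm n (residual n t w f) \<le> D\<^sup>2"
    using small_residuals[OF V1(1) D] by blast
  define B where "B = 2 * D * ln (12 * real (n + length P1) * (3 / 2 * real n + 1))"
  have cI: "card I \<le> n + length P1"
    unfolding I_def by (rule order_trans[OF card_Un_le]) simp
  obtain a where a: "\<And>p. p \<in> I \<Longrightarrow> cmod (\<Sum>l<n. F p l * a l) \<le> B"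
    and az: "(real n - real t) / 2 - 1 \<le> (\<Sum>\<nu><n. (cmod (\<Sum>l<n. fourier n \<nu> l * a l))\<^sup>2 -
      (cmod (\<Sum>l<n. fourier n \<nu> l * a l)) ^ 4 / 6)"
    unfolding B_def
    by (rule exists_good_input[OF on _ cI, of F D "fourier n"])
      (use n V1(2) res D in \<open>auto simp: I_def sqnorm_fourier fourier_orthogonal\<close>)
  have "1 < 12 * real (n + length P1) * (3 / 2 * real n + 1)"
  proof -
    have "1 * 1 < 12 * real (n + length P1) * (3 / 2 * real n + 1)"
      using n by (intro mult_strict_mono) auto
    then show ?thesis by simp
  qed
  then have B: "0 < B" using D by (simp add: B_def)
  obtain H where H: "\<And>s V C. bc_span (unit_vector ` {..<n} \<union> H ` {..<n}) s V \<Longrightarrow>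
    (\<And>k. k < n \<Longrightarrow> C k \<in> V) \<Longrightarrow>
    (\<And>k l. k < n \<Longrightarrow> l < n \<Longrightarrow> C k l = circulant n a k l / of_real B) \<Longrightarrow>
    (\<Prod>\<nu><n. 1 + sqrt (real n) * cmod (\<Sum>l<n. fourier n \<nu> l * a l) / B) \<le> 2 ^ (s + n)"
    using circulant_cost[OF n B, of a] by blast
  define V0 where "V0 = unit_vector ` {..<n} \<union> H ` {..<n}"
  \<comment> \<open>The input pair consisting of \<open>a\<close> and the \<open>l\<close>-th unit
    vector. As a function of \<open>l\<close>, a value of the run lists the coefficients of a linear
    form in the second argument.\<close>
  define X where "X l = (\<lambda>p. if p < n then a p else unit_vector l (p - n))" for l
  define r where "r p = (\<lambda>l. run N P (X l) ! p)" for p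
  \<comment> \<open>The division by \<open>B\<close> enters only at the products. The fourth part is
    linear in them, so it commutes with this common factor.\<close>
  define r' where "r' p = (\<lambda>l. run N P (X l) ! p / of_real B)" for p
  have r_in: "r p \<in> V0" if p: "p \<in> {n..<n + n}" for p
  proof -
    have "r p = unit_vector (p - n)"
      using p by (auto simp: r_def N_def nth_run_input X_def unit_vector_def fun_eq_iff)
    then show ?thesis using p by (auto simp: V0_def)
  qed
  have "\<exists>V'. bc_span V0 (0 + length P2) V' \<and> V0 \<subseteq> V' \<and>
      (\<forall>p\<in>{n..<n + n} \<union> {q2..<q2 + length P2}. r p \<in> V')"
    by (rule linear_part_bc_span[OF bc_span.init r_in L2 bc'(2)]) (auto simp: r_def R2)
  then obtain V2 where V2: "bc_span V0 (length P2) V2" "\<forall>p\<in>{n..<n + n} \<union> {q2..<q3}. r p \<in> V2"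
    by (auto simp: q3_def)
  have "\<exists>V'. bc_span V0 (length P2) V' \<and> V2 \<subseteq> V' \<and> (\<forall>t<length P3. r' (q3 + t) \<in> V')"
  proof (rule products_bc_span[OF V2(1)])
    fix t assume t: "t < length P3"
    then obtain i j where ij: "P3 ! t = Mult i j" "i \<in> I" "j \<in> {n..<n + n} \<union> {q2..<q3}"
      using L3[of "P3 ! t"] by (auto simp: I_def q2_def)
    \<comment> \<open>After substitution the left factor of the product is the constant
      \<open>c\<close>, of modulus at most \<open>B\<close>; the scaled product is thus a free
      shrinking of a vector of the second part.\<close>
    define c where "c = (\<Sum>l<n. F i l * a l)"
    have "run N P (X l) ! i = c" for l
      unfolding form1[OF ij(2)] c_def by (intro sum.cong) (auto simp: X_def)
    then have "r' (q3 + t) = (\<lambda>l. c / of_real B * r j l)"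
      by (simp add: r'_def r_def R3[OF t] ij(1))
    moreover have "cmod (c / of_real B) \<le> 1"
      using a[OF ij(2)] B by (simp add: c_def norm_divide)
    ultimately show "\<exists>a u. u \<in> V2 \<and> cmod a \<le> 1 \<and> r' (q3 + t) = (\<lambda>l. a * u l)"
      using V2(2) ij(3) by blast
  qed
  then obtain V3 where V3: "bc_span V0 (length P2) V3" "\<forall>t<length P3. r' (q3 + t) \<in> V3" by blast
  have V3': "r' p \<in> V3" if "p \<in> {q3..<q4}" for p
    using V3(2) that by (auto simp: q4_def dest!: le_Suc_ex)
  have "\<exists>V'. bc_span V0 (length P2 + length P4) V' \<and> V3 \<subseteq> V' \<and>
      (\<forall>p\<in>{q3..<q4} \<union> {q4..<q4 + length P4}. r' p \<in> V')"
    by (rule linear_part_bc_span[OF V3(1) V3' L4 bc'(3)])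
      (auto simp: r'_def R4 add_divide_distrib diff_divide_distrib)
  then obtain V4 where V4: "bc_span V0 (length P2 + length P4) V4"
    and r': "\<forall>p\<in>{q3..<q4} \<union> {q4..<q4 + length P4}. r' p \<in> V4" by blast
  have V4': "r' p \<in> V4" if "p \<in> {q3..<q4 + length P4}" for p
    using that r' by (cases "p < q4") auto
  have "\<exists>p\<in>{q3..<q4 + length P4}. \<forall>x. run N P x ! p = conv n x (\<lambda>j. x (n + j)) k"
    if k: "k < n" for k
  proof -
    obtain p where p: "p < N + length P" "\<And>x. run N P x ! p = conv n x (\<lambda>j. x (n + j)) k"
      using comp[unfolded computes_def, rule_format, OF imageI[of k]] k unfolding N_def by auto
    have "p \<notin> I"
    proof
      assume "p \<in> I"
      show False
        by (rule conv_output_position[OF n k p(2) _ form1[OF \<open>p \<in> I\<close>]]) simp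
    qed
    moreover have "p \<notin> {n..<n + n} \<union> {q2..<q2 + length P2}"
    proof
      assume p': "p \<in> {n..<n + n} \<union> {q2..<q2 + length P2}"
      show False
        by (rule conv_output_position[OF n k p(2) _ form2[OF p']]) simp
    qed
    ultimately have "p \<in> {q3..<q4 + length P4}"
    proof -
      have len: "N + length P = q4 + length P4"
        by (simp add: P q4_def q3_def q2_def)
      assume "p \<notin> I" "p \<notin> {n..<n + n} \<union> {q2..<q2 + length P2}"
      then have "n \<le> p" "N \<le> p \<Longrightarrow> q2 \<le> p" "n \<le> p \<Longrightarrow> N \<le> p" "q2 \<le> p \<Longrightarrow> q3 \<le> p"
        unfolding I_def q2_def[symmetric] q3_def[symmetric] N_def[symmetric] by (simp_all add: not_less)
      then show ?thesis using p(1) len by simp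
    qed
    then show ?thesis using p(2) by blast
  qed
  then obtain out where out: "\<And>k. k < n \<Longrightarrow> out k \<in> {q3..<q4 + length P4}"
    "\<And>k x. k < n \<Longrightarrow> run N P x ! out k = conv n x (\<lambda>j. x (n + j)) k" by metis
  have C: "r' (out k) l = circulant n a k l / of_real B" if "k < n" "l < n" for k l
  proof -
    have "run N P (X l) ! out k = conv n a (unit_vector l) k"
      unfolding out(2)[OF that(1)] by (rule conv_cong) (auto simp: X_def)
    then show ?thesis using conv_unit_vector[OF that] by (simp add: r'_def)
  qed
  show thesis
  proof (rule that[of "length P1" "length P2 + length P4" t "\<lambda>\<nu>. cmod (\<Sum>l<n. fourier n \<nu> l * a l)"])
    show "(\<Prod>\<nu><n. 1 + sqrt (real n) * cmod (\<Sum>l<n. fourier n \<nu> l * a l) /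
        (2 * D * ln (12 * real (n + length P1) * (3 / 2 * real n + 1)))) \<le>
        2 ^ (length P2 + length P4 + n)"
      unfolding B_def[symmetric]
    proof (rule H[OF V4(1)[unfolded V0_def]])
      show "r' (out k) \<in> V4" if "k < n" for k using V4' out(1)[OF that] .
      show "r' (out k) l = circulant n a k l / of_real B" if "k < n" "l < n" for k l
        using C[OF that] .
    qed
    show "length P1 + (length P2 + length P4) \<le> length P" by (simp add: P)
  qed (use Dt az in simp_all)
qed

section \<open>Existence of a circuit\<close>

definition additive_part :: "nat \<Rightarrow> circuit \<Rightarrow> circuit \<Rightarrow> bool" where
  "additive_part N P Q \<longleftrightarrow>
     linear_part {N..<N + length P} (N + length P) Q \<and> (\<forall>c\<in>set Q. \<exists>i j. c = Add i j)"

text \<open>Inputs are excluded, since the fourth part of a bilinear circuit may refer only to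
  products and its own results.\<close>

definition available :: "nat \<Rightarrow> circuit \<Rightarrow> ((nat \<Rightarrow> complex) \<Rightarrow> complex) \<Rightarrow> bool" where
  "available N P f \<longleftrightarrow> (\<exists>p\<in>{N..<N + length P}. \<forall>x. run N P x ! p = f x)"

lemma available_append: "available N P f \<Longrightarrow> available N (P @ Q) f"
  unfolding available_def by (metis (no_types, lifting) atLeastLessThan_iff length_append nth_run_append
      trans_less_add1 add.assoc)

lemma additive_part_add:
  assumes Q: "additive_part N P Q" and f: "available N (P @ Q) f" and g: "available N (P @ Q) g"
  shows "\<exists>R. additive_part N P (Q @ R) \<and> available N (P @ Q @ R) (\<lambda>x. f x + g x)"
proof -
  obtain i j where i: "i \<in> {N..<N + length (P @ Q)}" "\<And>x. run N (P @ Q) x ! i = f x"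
    and j: "j \<in> {N..<N + length (P @ Q)}" "\<And>x. run N (P @ Q) x ! j = g x"
    using f g unfolding available_def by blast
  have "additive_part N P (Q @ [Add i j])"
    using Q i j unfolding additive_part_def linear_part_def
    by (auto simp: nth_append less_Suc_eq)
  moreover have "run N ((P @ Q) @ [Add i j]) x ! (N + length (P @ Q)) = f x + g x" for x
    unfolding run_snoc using i(2) j(2) by (simp add: nth_append)
  then have "available N (P @ Q @ [Add i j]) (\<lambda>x. f x + g x)"
    unfolding available_def by (intro bexI[of _ "N + length (P @ Q)"]) auto
  ultimately show ?thesis by blast
qed

lemma additive_part_sum:
  assumes "finite A" "A \<noteq> {}" and "additive_part N P Q" and "\<And>q. q \<in> A \<Longrightarrow> available N P (f q)"
  shows "\<exists>R. additive_part N P (Q @ R) \<and> available N (P @ Q @ R) (\<lambda>x. \<Sum>q\<in>A. f q x)"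
  using assms
proof (induction A rule: finite_ne_induct)
  case (singleton q)
  then show ?case
    using available_append[of N P "f q" Q] by (intro exI[of _ "[]"]) simp
next
  case (insert q A)
  then obtain R where R: "additive_part N P (Q @ R)"
    "available N (P @ Q @ R) (\<lambda>x. \<Sum>q\<in>A. f q x)" by auto
  have "available N (P @ Q @ R) (f q)" using insert.prems(2) available_append by simp
  from additive_part_add[OF R(1) this R(2)] obtain R' where
    "additive_part N P (Q @ R @ R')" "available N (P @ Q @ R @ R') (\<lambda>x. f q x + (\<Sum>q\<in>A. f q x))"
    by auto
  then show ?case using insert.hyps by (intro exI[of _ "R @ R'"]) simp
qed

lemma conv_eq_sum_products:
  assumes "0 < n"
  shows "conv n a b k = (\<Sum>q | q < n * n \<and> (q div n + q mod n) mod n = k mod n. a (q div n) * b (q mod n))"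
  unfolding conv_def
proof (rule sum.reindex_bij_witness[of _ "\<lambda>q. (q div n, q mod n)" "\<lambda>(i, j). i * n + j"])
  fix x assume x: "x \<in> {(i, j). i < n \<and> j < n \<and> (i + j) mod n = k mod n}"
  then obtain i j where ij: "x = (i, j)" "i < n" "j < n" "(i + j) mod n = k mod n" by auto
  have "i * n + j < Suc i * n" using ij by simp
  also have "\<dots> \<le> n * n" using ij by (intro mult_right_mono) auto
  finally have "i * n + j < n * n" .
  then show "(case x of (i, j) \<Rightarrow> i * n + j) \<in> {q. q < n * n \<and> (q div n + q mod n) mod n = k mod n}"
    using ij by simp
qed (use assms in \<open>auto simp: less_mult_imp_div_less\<close>)

text \<open>\<open>LEAST\<close> is informative only if some circuit exists. The schoolbook method
  provides one: all n^2 products, with the pair (i, j) coded as q = i n + j, followed by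
  additions.\<close>

lemma conv_circuit_exists:
  assumes n: "0 < n"
  shows "\<exists>P. bilinear_circuit n n P \<and> bounded_coeff P \<and>
    computes (n + n) P ((\<lambda>k x. conv n x (\<lambda>j. x (n + j)) k) ` {..<n})"
proof -
  define P where "P = map (\<lambda>q. Mult (q div n) (n + q mod n)) [0..<n * n]"
  have div: "q div n < n" if "q < n * n" for q using that by (simp add: less_mult_imp_div_less)
  have ic: "is_circuit (n + n) P"
    unfolding is_circuit_def using div n by (auto simp: P_def intro: trans_less_add1)
  have prods: "available (n + n) P (\<lambda>x. x (q div n) * x (n + q mod n))" if "q < n * n" for q
    unfolding available_def
  proof (intro bexI allI)
    fix x
    show "run (n + n) P x ! (n + n + q) = x (q div n) * x (n + q mod n)"
      using that n div[OF that] nth_run_instr[OF ic, of q x]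
      by (simp add: P_def nth_run_input trans_less_add1)
  qed (use that in \<open>simp add: P_def\<close>)
  have "\<exists>Q. additive_part (n + n) P Q \<and>
      (\<forall>k<m. available (n + n) (P @ Q) (\<lambda>x. conv n x (\<lambda>j. x (n + j)) k))" for m
  proof (induction m)
    case 0
    show ?case by (intro exI[of _ "[]"]) (simp add: additive_part_def linear_part_def)
  next
    case (Suc m)
    then obtain Q where Q: "additive_part (n + n) P Q"
      "\<forall>k<m. available (n + n) (P @ Q) (\<lambda>x. conv n x (\<lambda>j. x (n + j)) k)" by blast
    define A where "A = {q. q < n * n \<and> (q div n + q mod n) mod n = m mod n}"
    \<comment> \<open>The pair (0, m mod n) shows that the sum is not empty, as
      \<open>additive_part_sum\<close> requires.\<close>
    have "m mod n < n * n"
      using n mod_less_divisor[of n m] by (meson le_square order_less_le_trans)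
    then have "m mod n \<in> A" using n by (simp add: A_def)
    then have "A \<noteq> {}" by blast
    moreover have "finite A" by (simp add: A_def)
    ultimately have "\<exists>R. additive_part (n + n) P (Q @ R) \<and>
        available (n + n) (P @ Q @ R) (\<lambda>x. \<Sum>q\<in>A. x (q div n) * x (n + q mod n))"
      by (intro additive_part_sum Q(1)) (auto simp: A_def intro: prods)
    then obtain R where R: "additive_part (n + n) P (Q @ R)"
      "available (n + n) (P @ Q @ R) (\<lambda>x. conv n x (\<lambda>j. x (n + j)) m)"
      unfolding conv_eq_sum_products[OF n] A_def by blast
    show ?case
    proof (intro exI[of _ "Q @ R"] conjI allI impI)
      fix k assume "k < Suc m"
      then show "available (n + n) (P @ Q @ R) (\<lambda>x. conv n x (\<lambda>j. x (n + j)) k)"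
        using R(2) Q(2) available_append[of "n + n" "P @ Q" _ R] by (cases "k = m") auto
    qed (rule R(1))
  qed
  then obtain Q where Q: "additive_part (n + n) P Q"
    "\<And>k. k < n \<Longrightarrow> available (n + n) (P @ Q) (\<lambda>x. conv n x (\<lambda>j. x (n + j)) k)" by blast
  have "bilinear_circuit n n (P @ Q)"
    unfolding bilinear_circuit_def Let_def
  proof (intro exI conjI)
    show "P @ Q = [] @ [] @ P @ Q" by simp
    show "\<forall>c\<in>set P. \<exists>i\<in>{..<n} \<union> {n + n..<n + n + length ([] :: circuit)}.
        \<exists>j\<in>{n..<n + n} \<union> {n + n + length ([] :: circuit)..<n + n + length ([] :: circuit) + length ([] :: circuit)}.
          c = Mult i j"
      using div n by (fastforce simp: P_def)
    show "linear_part {n + n + length ([] :: circuit) + length ([] :: circuit)..<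
        n + n + length ([] :: circuit) + length ([] :: circuit) + length P}
      (n + n + length ([] :: circuit) + length ([] :: circuit) + length P) Q"
      using Q(1) by (simp add: additive_part_def)
  qed (simp_all add: linear_part_def)
  moreover have "bounded_coeff (P @ Q)"
    using Q(1) unfolding bounded_coeff_def additive_part_def P_def by fastforce
  moreover have "computes (n + n) (P @ Q) ((\<lambda>k x. conv n x (\<lambda>j. x (n + j)) k) ` {..<n})"
    using Q(2) unfolding computes_def available_def by fastforce
  ultimately show ?thesis by blast
qed

section \<open>The lower bound\<close>

text \<open>For z \<le> 1/4 the left side is nonpositive, because 1/16 is the square of this
  threshold. Otherwise it is at most \<Lambda> by the maximum 3/2, and \<Lambda> is the logarithm of
  the right-hand quotient at z = 1/4.\<close>

lemma log_one_plus_ge: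
  fixes z B n :: real
  assumes z: "0 \<le> z" and B: "0 < B" and n: "0 < n" and \<Lambda>: "\<Lambda> = log 2 (sqrt n / (4 * B))" "0 \<le> \<Lambda>"
  shows "2 / 3 * \<Lambda> * (z\<^sup>2 - z ^ 4 / 6 - 1 / 16) \<le> log 2 (1 + sqrt n * z / B)"
proof (cases "z \<le> 1 / 4")
  case True
  have "z\<^sup>2 \<le> (1 / 4)\<^sup>2" using z True by (intro power_mono)
  moreover have "0 \<le> z ^ 4 / 6" by simp
  ultimately have "z\<^sup>2 - z ^ 4 / 6 - 1 / 16 \<le> 0" unfolding power2_eq_square[of "1 / 4 :: real"] by argo
  then have "2 / 3 * \<Lambda> * (z\<^sup>2 - z ^ 4 / 6 - 1 / 16) \<le> 0" using \<Lambda>(2) by (simp add: mult_nonneg_nonpos)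
  also have "0 \<le> log 2 (1 + sqrt n * z / B)" using z B n by (subst zero_le_log_cancel_iff) (auto intro: add_pos_nonneg)
  finally show ?thesis .
next
  case False
  have "2 / 3 * \<Lambda> * (z\<^sup>2 - z ^ 4 / 6 - 1 / 16) \<le> 2 / 3 * \<Lambda> * (3 / 2)"
    using \<Lambda>(2) square_sub_fourth_power_le[of z] by (intro mult_left_mono) auto
  also have "\<dots> = log 2 (sqrt n * (1 / 4) / B)" by (simp add: \<Lambda>(1))
  also have "\<dots> \<le> log 2 (1 + sqrt n * z / B)"
  proof (rule log_mono)
    have "sqrt n * (1 / 4) / B \<le> sqrt n * z / B"
      using False B n by (intro divide_right_mono mult_left_mono) auto
    then show "sqrt n * (1 / 4) / B \<le> 1 + sqrt n * z / B" by simp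
  qed (use B n in auto)
  finally show ?thesis .
qed

text \<open>A lower bound for \<Lambda> that depends on \<open>n\<close> alone: the length of the
  first part is replaced by n log n, which exceeds it in any circuit violating the claim. The factor
  8 is 4 from the threshold times 2 from \<open>B\<close>.\<close>

definition rate :: "nat \<Rightarrow> real" where
  "rate n = log 2 (sqrt (real n) / (8 * real n powr (1 / 8) *
     ln (12 * (real n + real n * log 2 (real n)) * (3 / 2 * real n + 1))))"

text \<open>\<open>rate n\<close> grows like 3/8 log n, so the right side of the second claim grows
  like 7/64 n log n.\<close>

lemma rate_asymptotics:
  "eventually (\<lambda>n. 0 \<le> rate n) at_top"
  "eventually (\<lambda>n. 1 / 12 * (real n * log 2 (real n)) \<le> 2 / 3 * rate n * (7 / 16 * real n - 1) - real n) at_top"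
  unfolding rate_def by real_asymp+

lemma conv_lower_bound:
  assumes n: "2 \<le> n" and bil: "bilinear_circuit n n P" and bc: "bounded_coeff P"
    and comp: "computes (n + n) P ((\<lambda>k x. conv n x (\<lambda>j. x (n + j)) k) ` {..<n})"
    and rate: "0 \<le> rate n"
      "1 / 12 * (real n * log 2 (real n)) \<le> 2 / 3 * rate n * (7 / 16 * real n - 1) - real n"
  shows "1 / 12 * (real n * log 2 (real n)) \<le> real (length P)"
proof (rule ccontr)
  assume "\<not> ?thesis"
  then have small: "real (length P) < 1 / 12 * (real n * log 2 (real n))" by simp
  define D where "D = real n powr (1 / 8)"
  have D: "1 < D" using n by (simp add: D_def)
  have logn: "1 \<le> log 2 (real n)" using n by simp
  obtain s1 s2 t z where s: "s1 + s2 \<le> length P" and Dt: "D ^ t \<le> 2 ^ s1" and z: "\<And>\<nu>. 0 \<le> z \<nu>"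
    and sum: "(real n - real t) / 2 - 1 \<le> (\<Sum>\<nu><n. (z \<nu>)\<^sup>2 - z \<nu> ^ 4 / 6)"
    and prod: "(\<Prod>\<nu><n. 1 + sqrt (real n) * z \<nu> /
       (2 * D * ln (12 * real (n + s1) * (3 / 2 * real n + 1)))) \<le> 2 ^ (s2 + n)"
    by (rule conv_circuit_bound[OF _ bil bc comp D]) (use n in auto)
  define B where "B = 2 * D * ln (12 * real (n + s1) * (3 / 2 * real n + 1))"
  define \<Lambda> where "\<Lambda> = log 2 (sqrt (real n) / (4 * B))"
  have "exp 1 \<le> 12 * real (n + s1) * (3 / 2 * real n + 1)"
  proof -
    have "exp 1 \<le> (12 * 1) * (1 :: real)" using exp_le by simp
    also have "\<dots> \<le> 12 * real (n + s1) * (3 / 2 * real n + 1)"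
      using n by (intro mult_mono) auto
    finally show ?thesis .
  qed
  then have ln1: "1 \<le> ln (12 * real (n + s1) * (3 / 2 * real n + 1))"
    using n by (subst ln_ge_iff) (auto intro!: mult_pos_pos add_pos_nonneg)
  then have DB: "D \<le> B" using D by (simp add: B_def)
  then have B: "0 < B" using D by simp
  have "ln (12 * real (n + s1) * (3 / 2 * real n + 1)) \<le>
      ln (12 * (real n + real n * log 2 (real n)) * (3 / 2 * real n + 1))"
  proof -
    have "real s1 \<le> 1 / 12 * (real n * log 2 (real n))" using s small by linarith
    also have "\<dots> \<le> real n * log 2 n" using logn by simp
    finally show ?thesis using n by (intro ln_mono mult_mono mult_pos_pos) auto
  qed
  then have "8 * D * ln (12 * real (n + s1) * (3 / 2 * real n + 1)) \<le>
      8 * D * ln (12 * (real n + real n * log 2 (real n)) * (3 / 2 * real n + 1))"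
    using D by (intro mult_left_mono) auto
  then have "4 * B \<le> 8 * real n powr (1 / 8) *
      ln (12 * (real n + real n * log 2 (real n)) * (3 / 2 * real n + 1))"
    unfolding B_def D_def by linarith
  then have "rate n \<le> \<Lambda>"
    unfolding rate_def \<Lambda>_def using B n
    by (intro log_mono divide_left_mono divide_pos_pos) (auto intro: mult_pos_pos less_le_trans[of 0 "4 * B"])
  then have \<Lambda>0: "0 \<le> \<Lambda>" using rate(1) by simp
  \<comment> \<open>An upper bound on \<Lambda> is needed too, since the loss caused by the
    \<open>t\<close> directions is proportional to it.\<close>
  have \<Lambda>n: "\<Lambda> \<le> 3 / 8 * log 2 (real n)"
  proof -
    have "\<Lambda> \<le> log 2 (sqrt (real n) / D)"
      unfolding \<Lambda>_def using DB D n B by (intro log_mono divide_left_mono) auto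
    also have "\<dots> = log 2 (real n powr (1 / 2) / real n powr (1 / 8))"
      using n by (simp add: D_def powr_half_sqrt)
    also have "\<dots> = 3 / 8 * log 2 (real n)"
      using n by (simp add: powr_diff[symmetric] log_powr)
    finally show ?thesis .
  qed
  have tbound: "real t * log 2 (real n) \<le> 8 * real s1"
  proof -
    have "log 2 (D ^ t) \<le> log 2 (2 ^ s1)" using Dt D by (intro log_mono) auto
    then have "real t * log 2 D \<le> real s1" using D by (simp add: log_nat_power)
    then show ?thesis using n by (simp add: D_def log_powr)
  qed
  have "2 / 3 * \<Lambda> * (((real n - real t) / 2 - 1) - real n / 16) \<le>
      2 / 3 * \<Lambda> * ((\<Sum>\<nu><n. (z \<nu>)\<^sup>2 - z \<nu> ^ 4 / 6) - real n / 16)"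
    using \<Lambda>0 sum by (intro mult_left_mono diff_right_mono) auto
  also have "\<dots> = (\<Sum>\<nu><n. 2 / 3 * \<Lambda> * ((z \<nu>)\<^sup>2 - z \<nu> ^ 4 / 6 - 1 / 16))"
    unfolding sum_distrib_left[symmetric] by (simp add: sum_subtractf)
  also have "\<dots> \<le> (\<Sum>\<nu><n. log 2 (1 + sqrt (real n) * z \<nu> / B))"
    using n by (intro sum_mono log_one_plus_ge z B \<Lambda>_def \<Lambda>0) auto
  also have "\<dots> = log 2 (\<Prod>\<nu><n. 1 + sqrt (real n) * z \<nu> / B)"
  proof -
    have "0 < 1 + sqrt (real n) * z \<nu> / B" for \<nu>
      using z[of \<nu>] B by (intro add_pos_nonneg) auto
    then have "ln (\<Prod>\<nu><n. 1 + sqrt (real n) * z \<nu> / B) = (\<Sum>\<nu><n. ln (1 + sqrt (real n) * z \<nu> / B))"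
      by (intro ln_prod) (simp_all add: less_imp_neq[THEN not_sym])
    then show ?thesis by (simp add: log_def sum_divide_distrib)
  qed
  also have "\<dots> \<le> log 2 (2 ^ (s2 + n))"
  proof (rule log_mono)
    have "0 < 1 + sqrt (real n) * z \<nu> / B" for \<nu>
      using z[of \<nu>] B by (intro add_pos_nonneg) auto
    then show "0 < (\<Prod>\<nu><n. 1 + sqrt (real n) * z \<nu> / B)" by (intro prod_pos) auto
  qed (use prod in \<open>simp_all add: B_def\<close>)
  also have "\<dots> = real s2 + real n" by (simp add: log_nat_power)
  finally have "2 / 3 * \<Lambda> * (((real n - real t) / 2 - 1) - real n / 16) \<le> real s2 + real n" .
  \<comment> \<open>Here 7/16 = 1/2 - 1/16, and the loss 2/3 * \<Lambda> * t/2 moves to the right.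
    The next steps bound it by \<open>s1\<close>.\<close>
  then have main: "2 / 3 * \<Lambda> * (7 / 16 * real n - 1) - real n \<le> real s2 + 1 / 3 * (\<Lambda> * real t)"
    by (simp add: field_simps)
  have "\<Lambda> * real t \<le> 3 / 8 * log 2 (real n) * real t"
    using \<Lambda>n by (intro mult_right_mono) auto
  also have "\<dots> \<le> 3 * real s1" using tbound by (simp add: mult.commute)
  finally have "2 / 3 * \<Lambda> * (7 / 16 * real n - 1) - real n \<le> real (length P)"
    using main s by linarith
  moreover have "1 / 12 * (real n * log 2 (real n)) \<le> 2 / 3 * \<Lambda> * (7 / 16 * real n - 1) - real n"
  \<comment> \<open>The factor is negative for \<open>n = 2\<close>; the second assumption on
    \<open>rate\<close> is then contradictory.\<close>
  proof (cases "7 / 16 * real n - 1 \<ge> 0")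
    case True
    have "2 / 3 * rate n * (7 / 16 * real n - 1) \<le> 2 / 3 * \<Lambda> * (7 / 16 * real n - 1)"
      using True \<open>rate n \<le> \<Lambda>\<close> by (intro mult_right_mono mult_left_mono) auto
    then show ?thesis using rate(2) by linarith
  next
    case False
    then have "2 / 3 * rate n * (7 / 16 * real n - 1) \<le> 0" using rate(1) by (simp add: mult_nonneg_nonpos)
    moreover have "0 < 1 / 12 * (real n * log 2 (real n))" using n logn by simp
    ultimately show ?thesis using rate(2) by linarith
  qed
  ultimately show False using small by linarith
qed

theorem theorem4p1:
  shows "\<exists>g :: nat \<Rightarrow> real. g \<in> O(\<lambda>n. real n * log 2 (log 2 (real n))) \<and>
    (\<forall>n\<ge>2. real (bc_complexity n n n (conv n)) \<ge> 1 / 12 * (real n * log 2 (real n)) - g n)"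
proof -
  obtain N0 where N0: "\<And>n. N0 \<le> n \<Longrightarrow> 0 \<le> rate n \<and>
      1 / 12 * (real n * log 2 (real n)) \<le> 2 / 3 * rate n * (7 / 16 * real n - 1) - real n"
    using eventually_conj[OF rate_asymptotics] unfolding eventually_at_top_linorder by blast
  \<comment> \<open>Below \<open>N0\<close> the error term equals the whole bound, so the claim is
    trivial there. Being eventually 0, \<open>g\<close> lies in the required class with constant
    0.\<close>
  define g where "g n = (if n < N0 then 1 / 12 * (real n * log 2 (real n)) else 0)" for n :: nat
  have "eventually (\<lambda>n. g n = 0) at_top"
    using eventually_ge_at_top[of N0] by eventually_elim (simp add: g_def)
  then have "g \<in> O(\<lambda>n. real n * log 2 (log 2 (real n)))"
    by (intro bigoI[of _ 0]) (auto elim: eventually_mono)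
  moreover have "1 / 12 * (real n * log 2 (real n)) - g n \<le> real (bc_complexity n n n (conv n))"
    if n: "2 \<le> n" for n
  proof (cases "n < N0")
    case True
    then show ?thesis by (simp add: g_def)
  next
    case False
    let ?Q = "\<lambda>s. \<exists>P. bilinear_circuit n n P \<and> bounded_coeff P \<and>
        computes (n + n) P ((\<lambda>k x. conv n x (\<lambda>j. x (n + j)) k) ` {..<n}) \<and> length P = s"
    have "\<exists>s. ?Q s" using conv_circuit_exists[of n] n by auto
    from LeastI_ex[OF this] obtain P where P: "bilinear_circuit n n P" "bounded_coeff P"
      "computes (n + n) P ((\<lambda>k x. conv n x (\<lambda>j. x (n + j)) k) ` {..<n})"
      "length P = bc_complexity n n n (conv n)"
      unfolding bc_complexity_def by blast
    have "1 / 12 * (real n * log 2 (real n)) \<le> real (length P)"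
      using N0[of n] False by (intro conv_lower_bound[OF n P(1,2,3)]) auto
    then show ?thesis using False P(4) by (simp add: g_def)
  qed
  ultimately show ?thesis by blast
qed

end
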